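(* Let $1\le m\leq n$, let $G'$ be a connected reductive group, let $\rho$ be a rational representation of $\operatorname{GL}(n)\times G'$ on a finite-dimensional complex vector space $F$, and let $G=\operatorname{GL}(m)\times\operatorname{GL}(n)\times G'$ act on $V=M_{m,n}\oplus F$ by $(g,h,g')\cdot(X,y)=((g^{t})^{-1}Xh^{-1},\rho(h,g')y)$. Let $H=\operatorname{GL}(m)\times\operatorname{GL}(n-m)\times G'\subset\operatorname{GL}(n)\times G'$, with $\operatorname{GL}(m)\times\operatorname{GL}(n-m)\subset\operatorname{GL}(n)$ the block-diagonal matrices, acting on $F$ via $\rho$. Let $v=\left(\begin{bmatrix}I_m&0\end{bmatrix},0\right)\in V$. Let $f\in\mathbb{C}[V]$ be a non-zero $G$-semi-invariant of weight $\sigma=\det^d\otimes\det^e\otimes\sigma'$, where $d,e\in\mathbb{N}$, $d\neq0$, and $\sigma'$ is a character of $G'$, and assume that $\det^{e-d}\otimes\det^e\otimes\sigma'$ is a multiplicity-free character of $H$ in $\mathbb{C}[F]$. Let $f_v\in\mathbb{C}[F]$ be the $H$-semi-invariant $f_v(y)=f(v+y)$. If $w\in F$ is the locally semi-simple point of $f_v$ (with respect to the action of $H$ on $F$), then $v+w$ is the locally semi-simple point of $f$ (with respect to the action of $G$ on $V$).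
   Context: Everything is over $\mathbb{C}$; $\mathbb{N}$ includes $0$. A group $G$ acting on $V$ acts on $\mathbb{C}[V]$ by $(g\cdot f)(x)=f(g^{-1}x)$; $f$ is a semi-invariant of weight $\sigma$ (a character of $G$) if $g\cdot f=\sigma(g)f$. A character $\sigma$ is multiplicity-free if, for every $k\in\mathbb{N}$, the space of semi-invariants of weight $\sigma^k$ is one-dimensional. For a connected reductive group $G$, a semi-invariant $f$ has multiplicity-free weight if and only if there is a unique closed orbit in the open set $\{f\neq0\}$ (closed in that open set); an element of this orbit is called "the" locally semi-simple point of $f$ (it is determined up to the group action). Under the stated hypotheses both $f_v$ and $f$ have multiplicity-free weight. *)

theory Defs
  imports
    "HOL-Analysis.Abstract_Topology"
    "HOL-Library.Function_Algebras"
    "HOL-Algebra.Group_Action"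
    "Jordan_Normal_Form.Matrix"
    "Jordan_Normal_Form.Determinant"
begin

section \<open>Polynomial functions and the Zariski topology\<close>

text \<open>
  An affine variety is given by a set of points \<open>S\<close> together with a set \<open>L\<close> of complex functions
  generating its algebra of regular functions.  Only the values of these functions on \<open>S\<close> matter.
\<close>

inductive_set poly_funs :: "('a \<Rightarrow> complex) set \<Rightarrow> ('a \<Rightarrow> complex) set"
  for L :: "('a \<Rightarrow> complex) set" where
  const: "(\<lambda>_. c) \<in> poly_funs L"
| gen: "l \<in> L \<Longrightarrow> l \<in> poly_funs L"
| add: "p \<in> poly_funs L \<Longrightarrow> q \<in> poly_funs L \<Longrightarrow> (\<lambda>x. p x + q x) \<in> poly_funs L"
| mult: "p \<in> poly_funs L \<Longrightarrow> q \<in> poly_funs L \<Longrightarrow> (\<lambda>x. p x * q x) \<in> poly_funs L"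

definition regular_on :: "'a set \<Rightarrow> ('a \<Rightarrow> complex) set \<Rightarrow> ('a \<Rightarrow> complex) \<Rightarrow> bool" where
  "regular_on S L f \<longleftrightarrow> (\<exists>p\<in>poly_funs L. \<forall>x\<in>S. f x = p x)"

text \<open>
  The ring \<open>\<complex>[S]\<close>; its elements are extended by \<open>0\<close> outside \<open>S\<close>, so that equality of HOL functions is
  equality on \<open>S\<close> and \<open>\<complex>[S]\<close> is a linear subspace of the space of all functions.
\<close>
definition coord_ring :: "'a set \<Rightarrow> ('a \<Rightarrow> complex) set \<Rightarrow> ('a \<Rightarrow> complex) set" where
  "coord_ring S L = {f. regular_on S L f \<and> (\<forall>x. x \<notin> S \<longrightarrow> f x = 0)}"

definition zariski :: "'a set \<Rightarrow> ('a \<Rightarrow> complex) set \<Rightarrow> 'a topology" where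
  "zariski S L = topology (\<lambda>U. \<exists>P\<subseteq>poly_funs L. U = S - {x \<in> S. \<forall>p\<in>P. p x = 0})"

lemma istopology_zariski:
  "istopology (\<lambda>U. \<exists>P\<subseteq>poly_funs L. U = S - {x \<in> S. \<forall>p\<in>P. p x = 0})"
  unfolding istopology_def
proof (intro conjI allI impI)
  fix U V
  assume "\<exists>P\<subseteq>poly_funs L. U = S - {x \<in> S. \<forall>p\<in>P. p x = 0}"
    and "\<exists>Q\<subseteq>poly_funs L. V = S - {x \<in> S. \<forall>q\<in>Q. q x = 0}"
  then obtain P Q where PQ: "P \<subseteq> poly_funs L" "Q \<subseteq> poly_funs L"
    "U = S - {x \<in> S. \<forall>p\<in>P. p x = 0}" "V = S - {x \<in> S. \<forall>q\<in>Q. q x = 0}" by blast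
  define R where "R = (\<lambda>(p, q) x. p x * q x) ` (P \<times> Q)"
  have ex: "(\<exists>r\<in>R. r x \<noteq> 0) \<longleftrightarrow> (\<exists>p\<in>P. p x \<noteq> 0) \<and> (\<exists>q\<in>Q. q x \<noteq> 0)" for x
    unfolding R_def by auto
  have "R \<subseteq> poly_funs L" using PQ(1,2) unfolding R_def by (auto intro: poly_funs.mult)
  moreover have "U \<inter> V = S - {x \<in> S. \<forall>r\<in>R. r x = 0}"
    unfolding PQ(3,4) using ex by auto
  ultimately show "\<exists>R\<subseteq>poly_funs L. U \<inter> V = S - {x \<in> S. \<forall>r\<in>R. r x = 0}" by blast
next
  fix \<U>
  assume "\<forall>U\<in>\<U>. \<exists>P\<subseteq>poly_funs L. U = S - {x \<in> S. \<forall>p\<in>P. p x = 0}"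
  from bchoice[OF this] obtain P where
    P: "\<forall>U\<in>\<U>. P U \<subseteq> poly_funs L \<and> U = S - {x \<in> S. \<forall>p\<in>P U. p x = 0}" ..
  have "(\<Union>U\<in>\<U>. P U) \<subseteq> poly_funs L" using P by blast
  moreover have "\<Union>\<U> = S - {x \<in> S. \<forall>p\<in>(\<Union>U\<in>\<U>. P U). p x = 0}"
  proof (intro equalityI subsetI)
    fix x assume "x \<in> \<Union>\<U>"
    then obtain U where U: "U \<in> \<U>" "x \<in> U" by blast
    with bspec[OF P U(1)] have "x \<in> S - {x \<in> S. \<forall>p\<in>P U. p x = 0}" by simp
    with U(1) show "x \<in> S - {x \<in> S. \<forall>p\<in>(\<Union>U\<in>\<U>. P U). p x = 0}" by blast
  next
    fix x assume "x \<in> S - {x \<in> S. \<forall>p\<in>(\<Union>U\<in>\<U>. P U). p x = 0}"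
    then obtain U where U: "U \<in> \<U>" "x \<in> S - {x \<in> S. \<forall>p\<in>P U. p x = 0}" by blast
    with bspec[OF P U(1)] have "x \<in> U" by simp
    with U(1) show "x \<in> \<Union>\<U>" by blast
  qed
  ultimately show "\<exists>R\<subseteq>poly_funs L. \<Union>\<U> = S - {x \<in> S. \<forall>r\<in>R. r x = 0}" by blast
qed

lemma openin_zariski:
  "openin (zariski S L) U \<longleftrightarrow> (\<exists>P\<subseteq>poly_funs L. U = S - {x \<in> S. \<forall>p\<in>P. p x = 0})"
  unfolding zariski_def by (subst topology_inverse'[OF istopology_zariski]) simp

lemma topspace_zariski: "topspace (zariski S L) = S"
proof
  show "topspace (zariski S L) \<subseteq> S"
    unfolding topspace_def openin_zariski by blast
  have "openin (zariski S L) S"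
    unfolding openin_zariski
    by (rule exI[of _ "{\<lambda>_. 1}"]) (auto intro: poly_funs.const)
  then show "S \<subseteq> topspace (zariski S L)" by (rule openin_subset)
qed

lemma closedin_zariski:
  "closedin (zariski S L) Z \<longleftrightarrow> (\<exists>P\<subseteq>poly_funs L. Z = {x \<in> S. \<forall>p\<in>P. p x = 0})"
proof
  assume "closedin (zariski S L) Z"
  then obtain P where P: "Z \<subseteq> S" "P \<subseteq> poly_funs L" "S - Z = S - {x \<in> S. \<forall>p\<in>P. p x = 0}"
    unfolding closedin_def topspace_zariski openin_zariski by auto
  from P(1,3) have "Z = {x \<in> S. \<forall>p\<in>P. p x = 0}" by blast
  with P(2) show "\<exists>P\<subseteq>poly_funs L. Z = {x \<in> S. \<forall>p\<in>P. p x = 0}" by blast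
next
  assume "\<exists>P\<subseteq>poly_funs L. Z = {x \<in> S. \<forall>p\<in>P. p x = 0}"
  then show "closedin (zariski S L) Z"
    unfolding closedin_def topspace_zariski openin_zariski by blast
qed

section \<open>Linear algebraic groups\<close>

definition GL :: "nat \<Rightarrow> complex mat monoid" where
  "GL n = units_of (ring_mat TYPE(complex) n ())"

definition mat_coords :: "nat \<Rightarrow> nat \<Rightarrow> (complex mat \<Rightarrow> complex) set" where
  "mat_coords r c = {(\<lambda>A. A $$ (i, j)) | i j. i < r \<and> j < c}"

definition GL_coords :: "nat \<Rightarrow> (complex mat \<Rightarrow> complex) set" where
  "GL_coords n = insert (\<lambda>A. inverse (det A)) (mat_coords n n)"

definition prod_coords ::
    "('a \<Rightarrow> complex) set \<Rightarrow> ('b \<Rightarrow> complex) set \<Rightarrow> ('a \<times> 'b \<Rightarrow> complex) set" where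
  "prod_coords L M = {(\<lambda>z. l (fst z)) | l. l \<in> L} \<union> {(\<lambda>z. l (snd z)) | l. l \<in> M}"

text \<open>A linear algebraic group is a Zariski closed subgroup of some \<open>GL N\<close>.\<close>

abbreviation subgroup_of_GL :: "nat \<Rightarrow> complex mat set \<Rightarrow> complex mat monoid" where
  "subgroup_of_GL N K \<equiv> (GL N)\<lparr>carrier := K\<rparr>"

definition linear_algebraic_group :: "nat \<Rightarrow> complex mat set \<Rightarrow> bool" where
  "linear_algebraic_group N K \<longleftrightarrow>
     subgroup K (GL N) \<and> closedin (zariski (carrier (GL N)) (GL_coords N)) K"

definition zariski_connected :: "nat \<Rightarrow> complex mat set \<Rightarrow> bool" where
  "zariski_connected N K \<longleftrightarrow> connectedin (zariski (carrier (GL N)) (GL_coords N)) K"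

definition unipotent_mats :: "nat \<Rightarrow> complex mat set \<Rightarrow> bool" where
  "unipotent_mats N K \<longleftrightarrow> (\<forall>A\<in>K. (A - 1\<^sub>m N) ^\<^sub>m N = 0\<^sub>m N N)"

text \<open>Reductive means that the unipotent radical, the largest closed connected normal unipotent
  subgroup, is trivial.\<close>
definition connected_reductive_group :: "nat \<Rightarrow> complex mat set \<Rightarrow> bool" where
  "connected_reductive_group N K \<longleftrightarrow>
     linear_algebraic_group N K \<and> zariski_connected N K \<and>
     (\<forall>U. linear_algebraic_group N U \<and> zariski_connected N U \<and> unipotent_mats N U \<and>
          U \<lhd> subgroup_of_GL N K \<longrightarrow> U = {1\<^sub>m N})"

text \<open>Below, \<open>\<Gamma>\<close> is the underlying abstract group and \<open>L\<close> generates its ring of regular functions.\<close>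

definition rational_character ::
    "('g, 'x) monoid_scheme \<Rightarrow> ('g \<Rightarrow> complex) set \<Rightarrow> ('g \<Rightarrow> complex) \<Rightarrow> bool" where
  "rational_character \<Gamma> L \<chi> \<longleftrightarrow>
     regular_on (carrier \<Gamma>) L \<chi> \<and>
     (\<forall>g\<in>carrier \<Gamma>. \<chi> g \<noteq> 0) \<and>
     (\<forall>g\<in>carrier \<Gamma>. \<forall>h\<in>carrier \<Gamma>. \<chi> (g \<otimes>\<^bsub>\<Gamma>\<^esub> h) = \<chi> g * \<chi> h)"

definition linear_functionals ::
    "(complex \<Rightarrow> 'f :: ab_group_add \<Rightarrow> 'f) \<Rightarrow> ('f \<Rightarrow> complex) set" where
  "linear_functionals scale = {\<phi>. Vector_Spaces.linear scale (*) \<phi>}"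

text \<open>Rationality: all matrix coefficients \<open>g \<mapsto> \<phi> (\<rho> g y)\<close> are regular functions on the group.\<close>
definition rational_representation ::
    "('g, 'x) monoid_scheme \<Rightarrow> ('g \<Rightarrow> complex) set \<Rightarrow> (complex \<Rightarrow> 'f :: ab_group_add \<Rightarrow> 'f) \<Rightarrow>
     ('g \<Rightarrow> 'f \<Rightarrow> 'f) \<Rightarrow> bool" where
  "rational_representation \<Gamma> L scale \<rho> \<longleftrightarrow>
     (\<forall>g\<in>carrier \<Gamma>. Vector_Spaces.linear scale scale (\<rho> g)) \<and>
     (\<forall>y. \<rho> \<one>\<^bsub>\<Gamma>\<^esub> y = y) \<and>
     (\<forall>g\<in>carrier \<Gamma>. \<forall>h\<in>carrier \<Gamma>. \<forall>y. \<rho> (g \<otimes>\<^bsub>\<Gamma>\<^esub> h) y = \<rho> g (\<rho> h y)) \<and>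
     (\<forall>\<phi>\<in>linear_functionals scale. \<forall>y. regular_on (carrier \<Gamma>) L (\<lambda>g. \<phi> (\<rho> g y)))"

section \<open>Semi-invariants\<close>

text \<open>Below, \<open>act\<close> is an action of \<open>\<Gamma>\<close> on the variety with points \<open>S\<close> and coordinates \<open>L\<close>.\<close>

definition semi_invariants ::
    "('g, 'x) monoid_scheme \<Rightarrow> ('g \<Rightarrow> 'a \<Rightarrow> 'a) \<Rightarrow> 'a set \<Rightarrow> ('a \<Rightarrow> complex) set \<Rightarrow>
     ('g \<Rightarrow> complex) \<Rightarrow> ('a \<Rightarrow> complex) set" where
  "semi_invariants \<Gamma> act S L \<chi> =
     {f \<in> coord_ring S L. \<forall>g\<in>carrier \<Gamma>. \<forall>x\<in>S. f (act (inv\<^bsub>\<Gamma>\<^esub> g) x) = \<chi> g * f x}"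

text \<open>The dimension is taken in the complex vector space of all functions, with pointwise operations.\<close>
definition multiplicity_free ::
    "('g, 'x) monoid_scheme \<Rightarrow> ('g \<Rightarrow> 'a \<Rightarrow> 'a) \<Rightarrow> 'a set \<Rightarrow> ('a \<Rightarrow> complex) set \<Rightarrow>
     ('g \<Rightarrow> complex) \<Rightarrow> bool" where
  "multiplicity_free \<Gamma> act S L \<chi> \<longleftrightarrow>
     (\<forall>k::nat. vector_space.dim (\<lambda>c f x. c * f x :: complex)
                 (semi_invariants \<Gamma> act S L (\<lambda>g. \<chi> g ^ k)) = 1)"

definition closed_orbits ::
    "('g, 'x) monoid_scheme \<Rightarrow> ('g \<Rightarrow> 'a \<Rightarrow> 'a) \<Rightarrow> 'a set \<Rightarrow> ('a \<Rightarrow> complex) set \<Rightarrow>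
     ('a \<Rightarrow> complex) \<Rightarrow> 'a set set" where
  "closed_orbits \<Gamma> act S L f =
     {\<Omega>. \<exists>x\<in>S. f x \<noteq> 0 \<and> \<Omega> = Group_Action.orbit \<Gamma> act x \<and>
           closedin (subtopology (zariski S L) {x \<in> S. f x \<noteq> 0}) \<Omega>}"

definition locally_semisimple_point ::
    "('g, 'x) monoid_scheme \<Rightarrow> ('g \<Rightarrow> 'a \<Rightarrow> 'a) \<Rightarrow> 'a set \<Rightarrow> ('a \<Rightarrow> complex) set \<Rightarrow>
     ('a \<Rightarrow> complex) \<Rightarrow> 'a \<Rightarrow> bool" where
  "locally_semisimple_point \<Gamma> act S L f w \<longleftrightarrow>
     (\<exists>\<Omega>. closed_orbits \<Gamma> act S L f = {\<Omega>} \<and> w \<in> \<Omega>)"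

section \<open>The groups \<open>G\<close> and \<open>H\<close> and their actions\<close>

text \<open>\<open>K \<subseteq> GL N\<close> plays the role of \<open>G'\<close>; the vector space \<open>F\<close> is the whole type \<open>'f\<close>.\<close>

definition G_group :: "nat \<Rightarrow> nat \<Rightarrow> nat \<Rightarrow> complex mat set \<Rightarrow>
    (complex mat \<times> complex mat \<times> complex mat) monoid" where
  "G_group m n N K = GL m \<times>\<times> (GL n \<times>\<times> subgroup_of_GL N K)"

definition V_space :: "nat \<Rightarrow> nat \<Rightarrow> (complex mat \<times> 'f) set" where
  "V_space m n = carrier_mat m n \<times> UNIV"

definition V_coords :: "nat \<Rightarrow> nat \<Rightarrow> (complex \<Rightarrow> 'f :: ab_group_add \<Rightarrow> 'f) \<Rightarrow>
    (complex mat \<times> 'f \<Rightarrow> complex) set" where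
  "V_coords m n scale = prod_coords (mat_coords m n) (linear_functionals scale)"

definition G_action :: "nat \<Rightarrow> nat \<Rightarrow> (complex mat \<times> complex mat \<Rightarrow> 'f \<Rightarrow> 'f) \<Rightarrow>
    complex mat \<times> complex mat \<times> complex mat \<Rightarrow> complex mat \<times> 'f \<Rightarrow> complex mat \<times> 'f" where
  "G_action m n \<rho> = (\<lambda>(g, h, k) (X, y).
     (inv\<^bsub>GL m\<^esub> (transpose_mat g) * X * inv\<^bsub>GL n\<^esub> h, \<rho> (h, k) y))"

definition G_weight :: "nat \<Rightarrow> nat \<Rightarrow> (complex mat \<Rightarrow> complex) \<Rightarrow>
    complex mat \<times> complex mat \<times> complex mat \<Rightarrow> complex" where
  "G_weight d e \<sigma>' = (\<lambda>(g, h, k). det g ^ d * det h ^ e * \<sigma>' k)"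

definition H_group :: "nat \<Rightarrow> nat \<Rightarrow> nat \<Rightarrow> complex mat set \<Rightarrow>
    (complex mat \<times> complex mat \<times> complex mat) monoid" where
  "H_group m n N K = GL m \<times>\<times> (GL (n - m) \<times>\<times> subgroup_of_GL N K)"

definition H_action :: "nat \<Rightarrow> nat \<Rightarrow> (complex mat \<times> complex mat \<Rightarrow> 'f \<Rightarrow> 'f) \<Rightarrow>
    complex mat \<times> complex mat \<times> complex mat \<Rightarrow> 'f \<Rightarrow> 'f" where
  "H_action m n \<rho> = (\<lambda>(a, b, k) y.
     \<rho> (four_block_mat a (0\<^sub>m m (n - m)) (0\<^sub>m (n - m) m) b, k) y)"

text \<open>The exponent \<open>e - d\<close> may be negative.\<close>
definition H_weight :: "nat \<Rightarrow> nat \<Rightarrow> (complex mat \<Rightarrow> complex) \<Rightarrow>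
    complex mat \<times> complex mat \<times> complex mat \<Rightarrow> complex" where
  "H_weight d e \<sigma>' = (\<lambda>(a, b, k). det a powi (int e - int d) * det b ^ e * \<sigma>' k)"

text \<open>The \<open>m \<times> n\<close> matrix \<open>[I\<^sub>m 0]\<close>.\<close>
definition id_zero_mat :: "nat \<Rightarrow> nat \<Rightarrow> complex mat" where
  "id_zero_mat m n = mat m n (\<lambda>(i, j). if i = j then 1 else 0)"

end

theory Submission
  imports Defs
    "HOL-Computational_Algebra.Fundamental_Theorem_Algebra"
    "Jordan_Normal_Form.Gauss_Jordan_Elimination"
begin

text \<open>
  For a rational action of a linear algebraic group, every nonempty stable set that is closed in a
  stable set \<open>\<Omega>\<close> contains an orbit closed in \<open>\<Omega>\<close>.  Orbits are constructible by Chevalley's theorem,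
  hence contain a nonempty open subset of their closure, and closures satisfy the descending chain
  condition by Hilbert's basis theorem; an orbit with minimal closure is therefore closed.

  Since \<open>d \<noteq> 0\<close>, \<open>f\<close> vanishes wherever the matrix component has rank less than \<open>m\<close>, so every \<open>G\<close>-orbit
  in \<open>{f \<noteq> 0}\<close> meets the slice \<open>v + F\<close>.  For an orbit closed in \<open>{f \<noteq> 0}\<close> this intersection is a nonempty
  \<open>H\<close>-stable closed subset of \<open>{f\<^sub>v \<noteq> 0}\<close>, so it contains an \<open>H\<close>-orbit closed there, which by uniqueness is
  the orbit of \<open>w\<close>.  Thus every closed \<open>G\<close>-orbit in \<open>{f \<noteq> 0}\<close> contains \<open>v + w\<close>, and one exists.
\<close>

section \<open>Hilbert's basis theorem\<close>

text \<open>When \<open>m < n\<close>, the stabilizer of \<open>v\<close> in \<open>G\<close> is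
  larger than the image of \<open>H\<close>: it also contains matrices of \<open>GL n\<close> with
  an arbitrary lower left block. The part of a \<open>G\<close>-orbit on the slice may therefore
  consist of many \<open>H\<close>-orbits, and a closed one has to be extracted from a stable closed
  set. This shapes the existence statement, which is applied to \<open>H\<close> with such a set and
  to \<open>G\<close> with the whole nonvanishing locus. Elimination removes quantifiers over
  complex numbers, one at a time, while orbits quantify over a group. Each group is therefore
  presented as the image of a closed subset of affine space, with the inverse determinant as an
  additional coordinate. Rings are sets of functions on a whole type. Since the matrix type contains
  matrices of all sizes, orbits and closures are cut down to the variety \<open>S\<close>.\<close>

definition is_subring :: "'a::comm_ring_1 set \<Rightarrow> bool" where
  "is_subring A \<longleftrightarrow> 1 \<in> A \<and> (\<forall>a\<in>A. \<forall>b\<in>A. a - b \<in> A \<and> a * b \<in> A)"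

lemma is_subringD:
  assumes "is_subring A"
  shows "1 \<in> A" "0 \<in> A" "a \<in> A \<Longrightarrow> - a \<in> A"
    "a \<in> A \<Longrightarrow> b \<in> A \<Longrightarrow> a + b \<in> A" "a \<in> A \<Longrightarrow> b \<in> A \<Longrightarrow> a - b \<in> A"
    "a \<in> A \<Longrightarrow> b \<in> A \<Longrightarrow> a * b \<in> A"
proof -
  show 1: "1 \<in> A" using assms by (simp add: is_subring_def)
  show d: "a - b \<in> A" if "a \<in> A" "b \<in> A" for a b
    using assms that by (simp add: is_subring_def)
  show 0: "0 \<in> A" using d[OF 1 1] by simp
  show m: "- a \<in> A" if "a \<in> A" for a using d[OF 0 that] by simp
  show "a + b \<in> A" if "a \<in> A" "b \<in> A" for a b using d[OF that(1) m[OF that(2)]] by simp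
  show "a * b \<in> A" if "a \<in> A" "b \<in> A" for a b
    using assms that by (simp add: is_subring_def)
qed

lemma is_subring_power: "is_subring A \<Longrightarrow> a \<in> A \<Longrightarrow> a ^ k \<in> A"
  by (induction k) (auto intro: is_subringD)

lemma is_subring_sum: "is_subring A \<Longrightarrow> (\<And>i. i \<in> I \<Longrightarrow> g i \<in> A) \<Longrightarrow> sum g I \<in> A"
  by (induction I rule: infinite_finite_induct) (auto intro: is_subringD)

definition is_ideal :: "'a::comm_ring_1 set \<Rightarrow> 'a set \<Rightarrow> bool" where
  "is_ideal A I \<longleftrightarrow> I \<subseteq> A \<and> 0 \<in> I \<and> (\<forall>a\<in>I. \<forall>b\<in>I. a + b \<in> I) \<and> (\<forall>r\<in>A. \<forall>a\<in>I. r * a \<in> I)"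

text \<open>Adding one multiple at a time makes every fact about generated ideals a two-case
  induction. The set \<open>B\<close> may be infinite: \<open>noetherian_finite_zero_set\<close>
  starts from arbitrarily many equations.\<close>

inductive_set ideal_gen :: "'a::comm_ring_1 set \<Rightarrow> 'a set \<Rightarrow> 'a set" for A B where
  zero: "0 \<in> ideal_gen A B"
| step: "r \<in> A \<Longrightarrow> b \<in> B \<Longrightarrow> s \<in> ideal_gen A B \<Longrightarrow> r * b + s \<in> ideal_gen A B"

lemma ideal_gen_add: "s \<in> ideal_gen A B \<Longrightarrow> t \<in> ideal_gen A B \<Longrightarrow> s + t \<in> ideal_gen A B"
  by (induction rule: ideal_gen.induct) (auto simp: add.assoc intro: ideal_gen.step)

lemma ideal_gen_mult:
  assumes "is_subring A" "r \<in> A" "s \<in> ideal_gen A B"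
  shows "r * s \<in> ideal_gen A B"
  using assms(3)
proof induction
  case (step a b s)
  have "(r * a) * b + r * s \<in> ideal_gen A B"
    using step is_subringD(6)[OF assms(1,2)] by (blast intro: ideal_gen.step)
  then show ?case by (simp add: algebra_simps)
qed (simp add: ideal_gen.zero)

lemma ideal_gen_base: "is_subring A \<Longrightarrow> b \<in> B \<Longrightarrow> b \<in> ideal_gen A B"
  using ideal_gen.step[of 1 A b B 0] by (simp add: is_subringD ideal_gen.zero)

lemma ideal_gen_subset:
  assumes "is_ideal A I" "B \<subseteq> I"
  shows "ideal_gen A B \<subseteq> I"
proof
  fix x assume "x \<in> ideal_gen A B"
  then show "x \<in> I" using assms by induction (auto simp: is_ideal_def)
qed

lemma is_ideal_ideal_gen:
  assumes "is_subring A" "B \<subseteq> A"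
  shows "is_ideal A (ideal_gen A B)"
proof -
  have "x \<in> A" if "x \<in> ideal_gen A B" for x
    using that assms by induction (auto intro: is_subringD)
  then show ?thesis
    using ideal_gen_mult[OF assms(1)] by (auto simp: is_ideal_def ideal_gen.zero ideal_gen_add)
qed

text \<open>Finite generation stated by one inclusion; for generators inside the ideal the opposite
  one is \<open>ideal_gen_subset\<close>.\<close>

definition noetherian :: "'a::comm_ring_1 set \<Rightarrow> bool" where
  "noetherian A \<longleftrightarrow> (\<forall>I. is_ideal A I \<longrightarrow> (\<exists>B\<subseteq>I. finite B \<and> I \<subseteq> ideal_gen A B))"

definition polys_over :: "'a::comm_ring_1 set \<Rightarrow> 'a poly set" where
  "polys_over A = {p. \<forall>i. coeff p i \<in> A}"

lemma polys_over_monom: "is_subring A \<Longrightarrow> c \<in> A \<Longrightarrow> monom c k \<in> polys_over A"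
  by (auto simp: polys_over_def is_subringD)

lemma polys_over_subring: "is_subring A \<Longrightarrow> is_subring (polys_over A)"
  unfolding is_subring_def[of "polys_over A"]
  by (auto simp: polys_over_def coeff_mult is_subringD intro!: is_subring_sum)

lemma polys_over_coeff: "p \<in> polys_over A \<Longrightarrow> coeff p i \<in> A"
  by (simp add: polys_over_def)

text \<open>The ideals \<open>J d\<close> of coefficients in degree \<open>d\<close> form an
  ascending chain, stationary from some \<open>N\<close> on. Lifting finitely many generators of
  each \<open>J d\<close> with \<open>d \<le> N\<close> gives enough polynomials to cancel the
  leading coefficient of any member of \<open>I\<close>; induction on the degree finishes.\<close>

lemma hilbert_basis:
  fixes A :: "'a::comm_ring_1 set"
  assumes A: "is_subring A" "noetherian A"
  shows "noetherian (polys_over A)"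
  unfolding noetherian_def
proof (intro allI impI)
  fix I assume I: "is_ideal (polys_over A) I"
  note Ps = polys_over_subring[OF A(1)]
  have I_sub: "I \<subseteq> polys_over A" and I0: "0 \<in> I" and I_add: "\<And>p q. p \<in> I \<Longrightarrow> q \<in> I \<Longrightarrow> p + q \<in> I"
    and I_mult: "\<And>r p. r \<in> polys_over A \<Longrightarrow> p \<in> I \<Longrightarrow> r * p \<in> I"
    using I by (auto simp: is_ideal_def)
  define J where "J d = {coeff p d | p. p \<in> I \<and> degree p \<le> d}" for d
  have J_ideal: "is_ideal A (J d)" for d
    unfolding is_ideal_def
  proof (intro conjI ballI)
    show "J d \<subseteq> A" using I_sub by (auto simp: J_def polys_over_def)
    show "0 \<in> J d" using I0 unfolding J_def by (auto intro!: exI[of _ 0])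
  next
    fix a b assume "a \<in> J d" "b \<in> J d"
    then obtain p q where "p \<in> I" "degree p \<le> d" "a = coeff p d" "q \<in> I" "degree q \<le> d" "b = coeff q d"
      by (auto simp: J_def)
    then show "a + b \<in> J d"
      unfolding J_def by (auto intro!: exI[of _ "p + q"] I_add degree_add_le)
  next
    fix r a assume r: "r \<in> A" and "a \<in> J d"
    then obtain p where p: "p \<in> I" "degree p \<le> d" "a = coeff p d"
      by (auto simp: J_def)
    have "monom r 0 * p \<in> I" using I_mult polys_over_monom[OF A(1) r] p by blast
    moreover have "monom r 0 * p = smult r p" by (simp add: monom_0)
    ultimately show "r * a \<in> J d"
      unfolding J_def using p degree_smult_le[of r p] by (auto intro!: exI[of _ "smult r p"])
  qed
  \<comment> \<open>Multiplication by X^(e - d) moves the coefficient from degree \<open>d\<close>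
    to degree \<open>e\<close>.\<close>
  have J_mono: "J d \<subseteq> J e" if "d \<le> e" for d e
  proof
    fix a assume "a \<in> J d"
    then obtain p where p: "p \<in> I" "degree p \<le> d" "a = coeff p d"
      by (auto simp: J_def)
    have "monom 1 (e - d) * p \<in> I"
      using I_mult polys_over_monom[OF A(1)] is_subringD(1)[OF A(1)] p by blast
    moreover have "degree (monom 1 (e - d) * p) \<le> e"
      using degree_mult_le[of "monom (1::'a) (e - d)" p] p(2) that by (simp add: degree_monom_eq)
    moreover have "coeff (monom 1 (e - d) * p) e = a"
      using that p by (simp add: coeff_monom_mult)
    ultimately show "a \<in> J e" unfolding J_def by blast
  qed
  have J_union: "is_ideal A (\<Union>d. J d)"
    unfolding is_ideal_def
  proof (intro conjI ballI)
    fix a b assume "a \<in> (\<Union>d. J d)" "b \<in> (\<Union>d. J d)"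
    then obtain d e where "a \<in> J d" "b \<in> J e" by blast
    then have "a \<in> J (max d e)" "b \<in> J (max d e)"
      using J_mono[of d "max d e"] J_mono[of e "max d e"] by auto
    then have "a + b \<in> J (max d e)" using J_ideal by (auto simp: is_ideal_def)
    then show "a + b \<in> (\<Union>d. J d)" by blast
  next
    show "(\<Union>d. J d) \<subseteq> A" "0 \<in> (\<Union>d. J d)"
      using J_ideal unfolding is_ideal_def by blast+
  next
    fix r a assume "r \<in> A" "a \<in> (\<Union>d. J d)"
    then show "r * a \<in> (\<Union>d. J d)" using J_ideal unfolding is_ideal_def by blast
  qed
  then obtain C where C: "C \<subseteq> (\<Union>d. J d)" "finite C" "(\<Union>d. J d) \<subseteq> ideal_gen A C"
    using A(2) by (auto simp: noetherian_def)
  \<comment> \<open>Finitely many elements of the union of a chain already lie in one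
    member.\<close>
  from C(2,1) have "\<exists>N. C \<subseteq> J N"
  proof (induction C)
    case (insert c C)
    then obtain N d where "C \<subseteq> J N" "c \<in> J d" by auto
    then have "insert c C \<subseteq> J (max N d)"
      using J_mono[of d "max N d"] J_mono[of N "max N d"] by auto
    then show ?case by blast
  qed simp
  then obtain N where "C \<subseteq> J N" ..
  then have J_N: "J d \<subseteq> J N" for d
    using C(3) ideal_gen_subset[OF J_ideal, of C N] by blast
  have "\<exists>B. B \<subseteq> I \<and> finite B \<and> (\<forall>b\<in>B. degree b \<le> d) \<and> J d \<subseteq> ideal_gen A ((\<lambda>b. coeff b d) ` B)" for d
  proof -
    obtain D where D: "D \<subseteq> J d" "finite D" "J d \<subseteq> ideal_gen A D"
      using A(2) J_ideal[of d] unfolding noetherian_def by blast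
    have "\<forall>a\<in>D. \<exists>p. p \<in> I \<and> degree p \<le> d \<and> a = coeff p d" using D(1) by (auto simp: J_def)
    then obtain g where g: "\<And>a. a \<in> D \<Longrightarrow> g a \<in> I \<and> degree (g a) \<le> d \<and> a = coeff (g a) d" by metis
    then have "(\<lambda>b. coeff b d) ` g ` D = D" by force
    with g D show ?thesis by (intro exI[of _ "g ` D"]) auto
  qed
  then obtain B where B: "\<And>d. B d \<subseteq> I" "\<And>d. finite (B d)" "\<And>d b. b \<in> B d \<Longrightarrow> degree b \<le> d"
    "\<And>d. J d \<subseteq> ideal_gen A ((\<lambda>b. coeff b d) ` B d)"
    by metis
  define BB where "BB = (\<Union>d\<le>N. B d)"
  \<comment> \<open>A combination of coefficients lifts to the same combination of polynomials, the
    scalars of \<open>A\<close> becoming constant polynomials \<open>monom r 0\<close>.\<close>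
  have lift: "\<exists>g\<in>ideal_gen (polys_over A) BB. degree g \<le> d \<and> coeff g d = a"
    if "d \<le> N" "a \<in> J d" for a d
  proof -
    from that(2) B(4) have "a \<in> ideal_gen A ((\<lambda>b. coeff b d) ` B d)" by blast
    then show ?thesis
    proof induction
      case zero
      show ?case by (intro bexI[of _ 0]) (auto intro: ideal_gen.zero)
    next
      case (step r b s)
      then obtain g h where g: "g \<in> ideal_gen (polys_over A) BB" "degree g \<le> d" "coeff g d = s"
        and h: "h \<in> B d" "b = coeff h d" by blast
      have "monom r 0 * h + g \<in> ideal_gen (polys_over A) BB"
        using h(1) g(1) that(1) polys_over_monom[OF A(1) step.hyps(1)] unfolding BB_def
        by (blast intro: ideal_gen.step)
      moreover have "degree (monom r 0 * h + g) \<le> d"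
        using g(2) B(3)[OF h(1)] degree_smult_le[of r h]
        by (intro degree_add_le) (auto simp: monom_0)
      moreover have "coeff (monom r 0 * h + g) d = r * b + s"
        using g h by (simp add: monom_0)
      ultimately show ?case by blast
    qed
  qed
  have "p \<in> ideal_gen (polys_over A) BB" if "p \<in> I" for p
    using that
  \<comment> \<open>The measure puts \<open>0\<close> strictly below the nonzero constants, so a
    constant that cancels completely still becomes smaller.\<close>
  proof (induction "if p = 0 then 0 else Suc (degree p)" arbitrary: p rule: less_induct)
    case less
    show ?case
    proof (cases "p = 0")
      case True
      then show ?thesis by (simp add: ideal_gen.zero)
    next
      case False
      define d where "d = degree p"
      \<comment> \<open>Generators were chosen only up to degree \<open>N\<close>; beyond it,
        \<open>J d \<subseteq> J N\<close> supplies a polynomial of degree at most \<open>N\<close>,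
        which \<open>h\<close> shifts back up to degree \<open>d\<close>.\<close>
      define e where "e = min d N"
      have "coeff p d \<in> J e"
      proof (cases "d \<le> N")
        case True
        then show ?thesis using less.prems by (auto simp: J_def d_def e_def)
      next
        case f: False
        have "coeff p d \<in> J d" using less.prems by (auto simp: J_def d_def)
        then show ?thesis using f J_N[of d] by (auto simp: e_def)
      qed
      then obtain g where g: "g \<in> ideal_gen (polys_over A) BB" "degree g \<le> e" "coeff g e = coeff p d"
        using lift[of e] by (auto simp: e_def)
      have ed: "e \<le> d" by (simp add: e_def)
      define h where "h = monom 1 (d - e) * g"
      have h: "h \<in> ideal_gen (polys_over A) BB"
        unfolding h_def
        by (intro ideal_gen_mult Ps g polys_over_monom A is_subringD(1)[OF A(1)])
      have hI: "h \<in> I"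
        using ideal_gen_subset[OF I, of BB] B(1) h unfolding BB_def by blast
      have dh: "degree h \<le> d"
        using degree_mult_le[of "monom (1::'a) (d - e)" g] g(2) ed by (simp add: h_def degree_monom_eq)
      have ch: "coeff h d = coeff p d"
        using g(3) ed by (simp add: h_def coeff_monom_mult)
      have "- 1 \<in> polys_over A" using is_subringD[OF Ps] by blast
      then have "- 1 * h \<in> I" using hI I_mult by blast
      from I_add[OF less.prems this] have phI: "p - h \<in> I" by simp
      have "(if p - h = 0 then 0 else Suc (degree (p - h))) < Suc d"
      proof (cases "p - h = 0")
        case nz: False
        have "degree (p - h) \<le> d" using dh by (intro degree_diff_le) (auto simp: d_def)
        moreover have "degree (p - h) \<noteq> d"
        proof
          assume "degree (p - h) = d"
          with nz have "coeff (p - h) d \<noteq> 0" by (metis leading_coeff_0_iff)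
          with ch show False by simp
        qed
        ultimately show ?thesis using nz by simp
      qed simp
      then have "p - h \<in> ideal_gen (polys_over A) BB"
        using less.hyps[of "p - h"] phI False by (simp add: d_def)
      from ideal_gen_add[OF this h] show ?thesis by simp
    qed
  qed
  moreover have "BB \<subseteq> I" "finite BB" using B by (auto simp: BB_def)
  ultimately show "\<exists>B\<subseteq>I. finite B \<and> I \<subseteq> ideal_gen (polys_over A) B" by blast
qed

text \<open>Noetherianity passes to a homomorphic image: the preimage of an ideal is an ideal, and
  the images of its generators generate.\<close>

lemma noetherian_eval:
  assumes A: "is_subring A" "noetherian (polys_over A)"
  shows "noetherian ((\<lambda>p. poly p a) ` polys_over A)"
  unfolding noetherian_def
proof (intro allI impI)
  let ?e = "\<lambda>p. poly p a"
  fix I assume I: "is_ideal (?e ` polys_over A) I"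
  note Ps = polys_over_subring[OF A(1)]
  have "is_ideal (polys_over A) {p \<in> polys_over A. ?e p \<in> I}"
    using I is_subringD[OF Ps] unfolding is_ideal_def by auto
  then obtain B where B: "B \<subseteq> {p \<in> polys_over A. ?e p \<in> I}" "finite B"
    "{p \<in> polys_over A. ?e p \<in> I} \<subseteq> ideal_gen (polys_over A) B"
    using A(2) unfolding noetherian_def by blast
  have "?e p \<in> ideal_gen (?e ` polys_over A) (?e ` B)" if "p \<in> ideal_gen (polys_over A) B" for p
    using that by induction (auto intro: ideal_gen.intros)
  moreover have "I \<subseteq> ?e ` polys_over A" using I by (simp add: is_ideal_def)
  ultimately have "I \<subseteq> ideal_gen (?e ` polys_over A) (?e ` B)" using B(3) by blast
  then show "\<exists>B\<subseteq>I. finite B \<and> I \<subseteq> ideal_gen (?e ` polys_over A) B"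
    using B by (intro exI[of _ "?e ` B"]) auto
qed

section \<open>Rings of polynomial functions\<close>

lemma poly_funs_subring: "is_subring (poly_funs L)"
  unfolding is_subring_def
proof (intro conjI ballI)
  show "1 \<in> poly_funs L" using poly_funs.const[of 1] by (simp add: one_fun_def)
next
  fix p q assume pq: "p \<in> poly_funs L" "q \<in> poly_funs L"
  have "(\<lambda>x. p x + (\<lambda>_. - 1) x * q x) \<in> poly_funs L"
    by (intro poly_funs.add poly_funs.mult poly_funs.const pq)
  then show "p - q \<in> poly_funs L" by (simp add: fun_diff_def)
  show "p * q \<in> poly_funs L" using poly_funs.mult[OF pq] by (simp add: times_fun_def)
qed

lemma poly_funs_induct [consumes 1, case_names const gen add mult]:
  assumes "f \<in> poly_funs L" "\<And>c. P (\<lambda>_. c)" "\<And>l. l \<in> L \<Longrightarrow> P l"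
    "\<And>p q. p \<in> poly_funs L \<Longrightarrow> q \<in> poly_funs L \<Longrightarrow> P p \<Longrightarrow> P q \<Longrightarrow> P (p + q)"
    "\<And>p q. p \<in> poly_funs L \<Longrightarrow> q \<in> poly_funs L \<Longrightarrow> P p \<Longrightarrow> P q \<Longrightarrow> P (p * q)"
  shows "P f"
  using assms(1)
  by induction (use assms(2-) in \<open>auto simp: plus_fun_def times_fun_def\<close>)

lemma poly_funs_subset:
  assumes "L \<subseteq> poly_funs M"
  shows "poly_funs L \<subseteq> poly_funs M"
proof
  fix p assume "p \<in> poly_funs L"
  then show "p \<in> poly_funs M"
    by induction (use assms in \<open>auto intro: poly_funs.intros\<close>)
qed

lemma poly_funs_mono: "L \<subseteq> M \<Longrightarrow> poly_funs L \<subseteq> poly_funs M"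
  by (rule poly_funs_subset) (auto intro: poly_funs.gen)

text \<open>With A = \<open>poly_funs L\<close>, adjoining \<open>l\<close> gives the image of A[X]
  under X \<mapsto> \<open>l\<close>, where \<open>l\<close> may satisfy relations over A. This
  drives the Noetherian induction and later turns a coordinate into a polynomial variable.\<close>

lemma poly_funs_insert: "poly_funs (insert l L) = (\<lambda>p. poly p l) ` polys_over (poly_funs L)"
proof (intro equalityI subsetI)
  let ?P = "polys_over (poly_funs L)"
  note Ps = polys_over_subring[OF poly_funs_subring, of L]
  have base: "g \<in> (\<lambda>p. poly p l) ` ?P" if "g \<in> poly_funs L" for g
    by (rule image_eqI[of _ _ "monom g 0"])
      (auto simp: poly_monom intro: polys_over_monom poly_funs_subring that)
  fix f assume "f \<in> poly_funs (insert l L)"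
  then show "f \<in> (\<lambda>p. poly p l) ` ?P"
  proof (induction rule: poly_funs_induct)
    case (gen k)
    show ?case
    proof (cases "k = l")
      case True
      then show ?thesis
        by (intro image_eqI[of _ _ "monom 1 1"])
          (auto simp: poly_monom intro!: polys_over_monom poly_funs_subring is_subringD(1))
    qed (use gen base in \<open>auto intro: poly_funs.gen\<close>)
  next
    case (add p q)
    then obtain P Q where "P \<in> ?P" "Q \<in> ?P" "p = poly P l" "q = poly Q l" by blast
    then show ?case using is_subringD(4)[OF Ps] by (intro image_eqI[of _ _ "P + Q"]) auto
  next
    case (mult p q)
    then obtain P Q where "P \<in> ?P" "Q \<in> ?P" "p = poly P l" "q = poly Q l" by blast
    then show ?case using is_subringD(6)[OF Ps] by (intro image_eqI[of _ _ "P * Q"]) auto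
  qed (auto intro: base poly_funs.const)
next
  fix f assume "f \<in> (\<lambda>p. poly p l) ` polys_over (poly_funs L)"
  then obtain P where P: "P \<in> polys_over (poly_funs L)" "f = poly P l" by blast
  note R = poly_funs_subring[of "insert l L"]
  have "poly P l = (\<Sum>i\<le>degree P. coeff P i * l ^ i)" by (rule poly_altdef)
  also have "\<dots> \<in> poly_funs (insert l L)"
    using polys_over_coeff[OF P(1)] poly_funs_mono[of L "insert l L"]
    by (intro is_subring_sum[OF R] is_subringD(6)[OF R] is_subring_power[OF R])
      (auto intro: poly_funs.gen)
  finally show "f \<in> poly_funs (insert l L)" using P by simp
qed

lemma poly_funs_empty: "poly_funs {} = range (\<lambda>c _. c)"
proof (intro equalityI subsetI)
  fix f :: "'a \<Rightarrow> complex" assume "f \<in> poly_funs {}"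
  then show "f \<in> range (\<lambda>c _. c)" by induction auto
qed (auto intro: poly_funs.const)

text \<open>The constants form a field, which has only two ideals; each further generator costs one
  use of Hilbert's theorem and one evaluation.\<close>

lemma noetherian_poly_funs:
  assumes "finite L"
  shows "noetherian (poly_funs L)"
  using assms
proof induction
  case empty
  show ?case unfolding noetherian_def
  proof (intro allI impI)
    let ?A = "poly_funs {} :: ('a \<Rightarrow> complex) set"
    fix I assume I: "is_ideal ?A I"
    show "\<exists>B\<subseteq>I. finite B \<and> I \<subseteq> ideal_gen ?A B"
    proof (cases "I \<subseteq> {0}")
      case True
      then show ?thesis by (intro exI[of _ "{}"]) (auto intro: ideal_gen.zero)
    next
      case False
      then obtain b where b: "b \<in> I" "b \<noteq> 0" by blast
      with I obtain c where c: "b = (\<lambda>_. c)" unfolding is_ideal_def poly_funs_empty by blast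
      with b have "c \<noteq> 0" by (auto simp: zero_fun_def)
      have "x \<in> ideal_gen ?A {b}" if "x \<in> I" for x
      proof -
        from that I obtain y where "x = (\<lambda>_. y)" unfolding is_ideal_def poly_funs_empty by blast
        then have "x = (\<lambda>_. y / c) * b + 0" using \<open>c \<noteq> 0\<close> c by (simp add: times_fun_def zero_fun_def plus_fun_def)
        moreover have "\<dots> \<in> ideal_gen ?A {b}"
          by (intro ideal_gen.intros poly_funs.const) auto
        ultimately show ?thesis by simp
      qed
      then show ?thesis using b by (intro exI[of _ "{b}"]) auto
    qed
  qed
next
  case (insert l L)
  show ?case unfolding poly_funs_insert
    by (intro noetherian_eval hilbert_basis poly_funs_subring insert.IH)
qed

section \<open>Constructible sets and Chevalley's theorem\<close>

lemma sum_fun_apply: "sum g I x = (\<Sum>i\<in>I. g i x)" for g :: "'i \<Rightarrow> 'x \<Rightarrow> complex"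
  by (induction I rule: infinite_finite_induct) auto

lemma power_fun_apply: "(g ^ k) x = g x ^ k" for g :: "'x \<Rightarrow> complex"
  by (induction k) auto

text \<open>A polynomial over a function ring has two arguments, the point and the variable to be
  eliminated; fixing the point leaves an ordinary complex polynomial. Its degree may drop, which is
  the source of all later case distinctions on leading coefficients.\<close>

definition specialize :: "('x \<Rightarrow> complex) poly \<Rightarrow> 'x \<Rightarrow> complex poly" where
  "specialize P x = map_poly (\<lambda>c. c x) P"

lemma coeff_specialize [simp]: "coeff (specialize P x) i = coeff P i x"
  by (simp add: specialize_def coeff_map_poly)

lemma specialize_simps [simp]:
  "specialize 0 x = 0"
  "specialize 1 x = 1"
  "specialize (P + Q) x = specialize P x + specialize Q x"
  "specialize (P - Q) x = specialize P x - specialize Q x"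
  "specialize (P * Q) x = specialize P x * specialize Q x"
  "specialize (smult c P) x = smult (c x) (specialize P x)"
  "specialize (monom c k) x = monom (c x) k"
  by (auto intro!: poly_eqI simp: coeff_mult sum_fun_apply coeff_1)

lemma specialize_power [simp]: "specialize (P ^ k) x = specialize P x ^ k"
  by (induction k) auto

lemma poly_fun_apply: "poly P l x = poly (specialize P x) (l x)" for l :: "'x \<Rightarrow> complex"
proof -
  have "degree (specialize P x) \<le> degree P" unfolding specialize_def by (rule map_poly_degree_leq)
  \<comment> \<open>The two sums may differ in length, since specializing can lower the degree; the
    surplus summands are zero.\<close>
  then show ?thesis
    unfolding poly_altdef sum_fun_apply times_fun_def power_fun_apply coeff_specialize[symmetric]
    by (intro sum.mono_neutral_right) (auto simp: not_le coeff_eq_0 simp del: coeff_specialize)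
qed

text \<open>Complements come for free from the two kinds of generators, by De Morgan. The sets live
  on the whole type; the variety \<open>S\<close> is intersected only afterwards.\<close>

inductive_set constructible :: "('x \<Rightarrow> complex) set \<Rightarrow> 'x set set" for R where
  eq: "p \<in> R \<Longrightarrow> {x. p x = 0} \<in> constructible R"
| neq: "p \<in> R \<Longrightarrow> {x. p x \<noteq> 0} \<in> constructible R"
| Un: "C \<in> constructible R \<Longrightarrow> D \<in> constructible R \<Longrightarrow> C \<union> D \<in> constructible R"
| Int: "C \<in> constructible R \<Longrightarrow> D \<in> constructible R \<Longrightarrow> C \<inter> D \<in> constructible R"

lemma constructible_empty: "is_subring R \<Longrightarrow> {} \<in> constructible R"
  using constructible.neq[of 0 R] by (simp add: is_subringD)

lemma constructible_UNIV: "is_subring R \<Longrightarrow> UNIV \<in> constructible R"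
  using constructible.eq[of 0 R] by (simp add: is_subringD)

lemma constructible_UN:
  assumes "is_subring R" "finite I" "\<And>i. i \<in> I \<Longrightarrow> C i \<in> constructible R"
  shows "(\<Union>i\<in>I. C i) \<in> constructible R"
  using assms(2,3) by (induction I) (auto intro: constructible.Un constructible_empty assms(1))

lemma constructible_INT:
  assumes "is_subring R" "finite I" "\<And>i. i \<in> I \<Longrightarrow> C i \<in> constructible R"
  shows "(\<Inter>i\<in>I. C i) \<in> constructible R"
  using assms(2,3) by (induction I) (auto intro: constructible.Int constructible_UNIV assms(1))

definition basic_set :: "('x \<Rightarrow> complex) list \<Rightarrow> ('x \<Rightarrow> complex) \<Rightarrow> 'x set" where
  "basic_set ps q = {x. (\<forall>p\<in>set ps. p x = 0) \<and> q x \<noteq> 0}"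

text \<open>Distributing intersections over unions leaves a finite union of locally closed pieces;
  two inequations merge into one for the product because \<complex> is a domain.\<close>

lemma constructible_normal_form:
  assumes R: "is_subring R" and "C \<in> constructible R"
  shows "\<exists>bs. (\<forall>(ps, q)\<in>set bs. set ps \<subseteq> R \<and> q \<in> R) \<and> C = (\<Union>(ps, q)\<in>set bs. basic_set ps q)"
  using assms(2)
proof induction
  case (eq p)
  then show ?case
    using is_subringD(1)[OF R] by (intro exI[of _ "[([p], 1)]"]) (auto simp: basic_set_def)
next
  case (neq p)
  then show ?case
    by (intro exI[of _ "[([], p)]"]) (auto simp: basic_set_def)
next
  case (Un C D)
  then obtain bs cs where
    "\<forall>(ps, q)\<in>set bs. set ps \<subseteq> R \<and> q \<in> R" "C = (\<Union>(ps, q)\<in>set bs. basic_set ps q)"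
    "\<forall>(ps, q)\<in>set cs. set ps \<subseteq> R \<and> q \<in> R" "D = (\<Union>(ps, q)\<in>set cs. basic_set ps q)"
    by blast
  then show ?case by (intro exI[of _ "bs @ cs"]) auto
next
  case (Int C D)
  then obtain bs cs where
    bc: "\<forall>(ps, q)\<in>set bs. set ps \<subseteq> R \<and> q \<in> R" "C = (\<Union>(ps, q)\<in>set bs. basic_set ps q)"
    "\<forall>(ps, q)\<in>set cs. set ps \<subseteq> R \<and> q \<in> R" "D = (\<Union>(ps, q)\<in>set cs. basic_set ps q)"
    by blast
  define ds where "ds = map (\<lambda>((ps, q), (ps', q')). (ps @ ps', q * q')) (List.product bs cs)"
  have "basic_set (ps @ ps') (q * q') = basic_set ps q \<inter> basic_set ps' q'" for ps ps' and q q' :: "'a \<Rightarrow> complex"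
    by (auto simp: basic_set_def)
  then have "(\<Union>(ps, q)\<in>set ds. basic_set ps q)
      = (\<Union>((ps, q), (ps', q'))\<in>set bs \<times> set cs. basic_set ps q \<inter> basic_set ps' q')"
    by (force simp: ds_def)
  also have "\<dots> = C \<inter> D" unfolding bc by fastforce
  finally have "C \<inter> D = (\<Union>(ps, q)\<in>set ds. basic_set ps q)" ..
  moreover have "\<forall>(ps, q)\<in>set ds. set ps \<subseteq> R \<and> q \<in> R"
    using bc(1,3) is_subringD(6)[OF R] by (fastforce simp: ds_def)
  ultimately show ?case by blast
qed

text \<open>The zero polynomial gets 1 and nonzero constants get 2: deleting a zero polynomial from
  a list and replacing a nonzero one by zero both lower the total weight.\<close>

definition poly_size :: "'a::zero poly \<Rightarrow> nat" where
  "poly_size p = (if p = 0 then 1 else degree p + 2)"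

lemma poly_size_less:
  assumes "degree p \<le> k" "coeff p k = 0"
  shows "poly_size p < k + 2"
proof (cases "p = 0")
  case False
  then have "degree p \<noteq> k" using assms(2) by (metis leading_coeff_0_iff)
  with assms(1) False show ?thesis by (simp add: poly_size_def)
qed (simp add: poly_size_def)

text \<open>One step of pseudo-division: the leading terms cancel without division by a leading
  coefficient, which is only a function. Wherever \<open>lead_coeff a\<close> is nonzero,
  \<open>a\<close> has the same common zeros with \<open>b\<close> as with
  \<open>reduce a b\<close>.\<close>

definition reduce :: "'a::comm_ring_1 poly \<Rightarrow> 'a poly \<Rightarrow> 'a poly" where
  "reduce a b = smult (lead_coeff a) b - monom (lead_coeff b) (degree b - degree a) * a"

lemma poly_size_reduce:
  assumes "b \<noteq> 0" "degree a \<le> degree b"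
  shows "poly_size (reduce a b) < poly_size b"
proof -
  have "degree (monom (lead_coeff b) (degree b - degree a) * a) \<le> degree b"
    using degree_mult_le[of "monom (lead_coeff b) (degree b - degree a)" a]
      degree_monom_le[of "lead_coeff b" "degree b - degree a"] assms(2) by simp
  then have "degree (reduce a b) \<le> degree b"
    unfolding reduce_def by (intro degree_diff_le degree_smult_le)
  moreover have "coeff (reduce a b) (degree b) = 0"
    using assms(2) by (simp add: reduce_def coeff_monom_mult)
  ultimately have "poly_size (reduce a b) < degree b + 2" by (rule poly_size_less)
  then show ?thesis using assms(1) by (simp add: poly_size_def)
qed

lemma polys_over_smult: "is_subring A \<Longrightarrow> c \<in> A \<Longrightarrow> p \<in> polys_over A \<Longrightarrow> smult c p \<in> polys_over A"
  by (auto simp: polys_over_def is_subringD)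

lemma polys_over_reduce:
  "is_subring A \<Longrightarrow> a \<in> polys_over A \<Longrightarrow> b \<in> polys_over A \<Longrightarrow> reduce a b \<in> polys_over A"
  unfolding reduce_def
  by (intro is_subringD(5,6)[OF polys_over_subring] polys_over_smult polys_over_monom
      polys_over_coeff)

text \<open>Repeated \<open>reduce\<close> steps; each costs one factor \<open>lead_coeff p\<close>,
  collected in the exponent \<open>k\<close>.\<close>

lemma pseudo_remainder:
  assumes A: "is_subring A" and p: "p \<in> polys_over A" and q: "q \<in> polys_over A"
  shows "\<exists>k s r. s \<in> polys_over A \<and> r \<in> polys_over A \<and>
    smult (lead_coeff p ^ k) q = p * s + r \<and> (r = 0 \<or> degree r < degree p)"
  using q
proof (induction "poly_size q" arbitrary: q rule: less_induct)
  case less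
  note P = is_subringD[OF polys_over_subring[OF A]]
  show ?case
  proof (cases "q = 0 \<or> degree q < degree p")
    case True
    then show ?thesis
      using P(2) less.prems by (intro exI[of _ 0] exI[of _ 0] exI[of _ q]) auto
  next
    case False
    then have "poly_size (reduce p q) < poly_size q" by (intro poly_size_reduce) auto
    with less obtain k s r where IH: "s \<in> polys_over A" "r \<in> polys_over A"
      "smult (lead_coeff p ^ k) (reduce p q) = p * s + r" "r = 0 \<or> degree r < degree p"
      using polys_over_reduce[OF A p] by blast
    define u where "u = smult (lead_coeff p ^ k) (monom (lead_coeff q) (degree q - degree p))"
    have "u \<in> polys_over A"
      unfolding u_def
      by (intro polys_over_smult polys_over_monom is_subring_power A polys_over_coeff p less.prems)
    moreover have "smult (lead_coeff p ^ Suc k) q = p * (s + u) + r"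
    proof -
      have "smult (lead_coeff p ^ Suc k) q = smult (lead_coeff p ^ k) (reduce p q) + u * p"
        by (simp add: reduce_def u_def smult_diff_right mult.commute)
      then show ?thesis unfolding IH(3) by (simp add: algebra_simps)
    qed
    ultimately show ?thesis using IH P(4) by blast
  qed
qed

section \<open>Elimination of one variable\<close>

lemma constructible_specialize_nonzero:
  assumes R: "is_subring R" and r: "r \<in> polys_over R"
  shows "{x. specialize r x \<noteq> 0} \<in> constructible R"
proof -
  have "{x. specialize r x \<noteq> 0} = (\<Union>i\<in>{..degree r}. {x. coeff r i x \<noteq> 0})"
  proof (intro equalityI subsetI)
    fix x assume "x \<in> {x. specialize r x \<noteq> 0}"
    then obtain i where i: "coeff r i x \<noteq> 0" by (auto simp: poly_eq_iff)
    then have "i \<le> degree r" by (intro le_degree) auto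
    with i show "x \<in> (\<Union>i\<in>{..degree r}. {x. coeff r i x \<noteq> 0})" by blast
  qed (auto simp: poly_eq_iff)
  then show ?thesis
    using r by (auto intro!: constructible_UN[OF R] constructible.neq simp: polys_over_def)
qed

lemma degree_specialize:
  assumes "lead_coeff p x \<noteq> 0"
  shows "degree (specialize p x) = degree p"
  using assms map_poly_degree_leq[of "\<lambda>c. c x" p] le_degree[of "specialize p x" "degree p"]
  by (simp add: specialize_def[symmetric])

text \<open>By the univariate Nullstellensatz, all roots of a nonzero complex polynomial p are roots
  of q iff p divides q^(deg p). Where the leading coefficient of \<open>p\<close> is nonzero the
  exponent does not depend on \<open>x\<close>, and a single pseudo-division decides divisibility
  for all these \<open>x\<close> at once.\<close>

lemma constructible_root_nonroot:
  assumes R: "is_subring R" and p: "p \<in> polys_over R" and q: "q \<in> polys_over R"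
  shows "{x. lead_coeff p x \<noteq> 0 \<and> (\<exists>t. poly (specialize p x) t = 0 \<and> poly (specialize q x) t \<noteq> 0)}
    \<in> constructible R"
proof -
  have "q ^ degree p \<in> polys_over R"
    by (intro is_subring_power polys_over_subring R q)
  then obtain k s r where r: "r \<in> polys_over R"
    "smult (lead_coeff p ^ k) (q ^ degree p) = p * s + r" "r = 0 \<or> degree r < degree p"
    using pseudo_remainder[OF R p] by blast
  have "(\<exists>t. poly (specialize p x) t = 0 \<and> poly (specialize q x) t \<noteq> 0) \<longleftrightarrow> specialize r x \<noteq> 0"
    if c: "lead_coeff p x \<noteq> 0" for x
  proof -
    let ?p = "specialize p x" and ?q = "specialize q x" and ?r = "specialize r x"
    note deg = degree_specialize[OF c]
    have "?p \<noteq> 0" using c by (metis coeff_0 coeff_specialize)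
    have "smult (lead_coeff p x ^ k) (?q ^ degree p) = ?p * specialize s x + ?r"
      using arg_cong[OF r(2), of "\<lambda>u. specialize u x"] by (simp add: power_fun_apply)
    \<comment> \<open>At this \<open>x\<close> the factor introduced by pseudo-division is a nonzero
      number and does not affect divisibility.\<close>
    then have "?p dvd ?q ^ degree p \<longleftrightarrow> ?p dvd ?r"
      using c by (metis dvd_smult_iff dvd_add_right_iff dvd_triv_left power_not_zero)
    also have "\<dots> \<longleftrightarrow> ?r = 0"
    proof
      assume "?p dvd ?r"
      show "?r = 0"
      proof (rule ccontr)
        assume "?r \<noteq> 0"
        then have "r \<noteq> 0" by auto
        \<comment> \<open>The divisor keeps its degree at \<open>x\<close>, while that of the
          remainder can only fall.\<close>
        then have "degree ?r < degree ?p"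
          using r(3) deg map_poly_degree_leq[of "\<lambda>c. c x" r] by (simp add: specialize_def)
        with \<open>?r \<noteq> 0\<close> \<open>?p dvd ?r\<close> show False by (simp add: dvd_imp_degree_le leD)
      qed
    qed simp
    finally show ?thesis
      using nullstellensatz_univariate[of ?p ?q] \<open>?p \<noteq> 0\<close> deg by auto
  qed
  then have "{x. lead_coeff p x \<noteq> 0 \<and> (\<exists>t. poly (specialize p x) t = 0 \<and> poly (specialize q x) t \<noteq> 0)}
      = {x. lead_coeff p x \<noteq> 0} \<inter> {x. specialize r x \<noteq> 0}"
    by blast
  also have "\<dots> \<in> constructible R"
    by (intro constructible.Int constructible.neq polys_over_coeff[OF p]
        constructible_specialize_nonzero[OF R r(1)])
  finally show ?thesis .
qed

text \<open>Euclid's algorithm carried out for all points \<open>x\<close> simultaneously, branching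
  on whether a leading coefficient vanishes at \<open>x\<close>. Every branch lowers the total
  weight, until there is no equation left, or a single one with nonvanishing leading
  coefficient.\<close>

lemma constructible_eliminate_basic:
  assumes R: "is_subring R" and ps: "set ps \<subseteq> polys_over R" and q: "q \<in> polys_over R"
  shows "{x. \<exists>t. (\<forall>p\<in>set ps. poly (specialize p x) t = 0) \<and> poly (specialize q x) t \<noteq> 0}
    \<in> constructible R"
  using ps
proof (induction "sum_list (map poly_size ps)" arbitrary: ps rule: less_induct)
  case less
  let ?S = "\<lambda>ps. {x. \<exists>t. (\<forall>p\<in>set ps. poly (specialize p x) t = 0) \<and> poly (specialize q x) t \<noteq> 0}"
  have pos: "poly_size p > 0" for p :: "('a \<Rightarrow> complex) poly" by (simp add: poly_size_def)
  \<comment> \<open>Where the leading coefficient of \<open>p\<close> vanishes, \<open>p\<close> may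
    be replaced by its truncation \<open>p'\<close>, which is smaller; only the locus of
    nonvanishing, assumption \<open>nz\<close>, remains.\<close>
  have split: "?S (p # ps') \<in> constructible R"
    if p: "p \<noteq> 0" "set (p # ps') \<subseteq> polys_over R"
      "sum_list (map poly_size (p # ps')) = sum_list (map poly_size ps)"
      and nz: "{x. lead_coeff p x \<noteq> 0} \<inter> ?S (p # ps') \<in> constructible R" for p ps'
  proof -
    define p' where "p' = p - monom (lead_coeff p) (degree p)"
    have "degree p' \<le> degree p"
      unfolding p'_def by (intro degree_diff_le degree_monom_le order_refl)
    then have "poly_size p' < degree p + 2"
      by (rule poly_size_less) (simp add: p'_def)
    then have "poly_size p' < poly_size p" using p(1) by (simp add: poly_size_def)
    moreover have "p' \<in> polys_over R"
      unfolding p'_def using p(2)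
      by (intro is_subringD(5)[OF polys_over_subring] R polys_over_monom polys_over_coeff) auto
    ultimately have "?S (p' # ps') \<in> constructible R"
      using p(2,3) by (intro less.hyps) auto
    moreover have "{x. lead_coeff p x = 0} \<in> constructible R"
      using p(2) by (intro constructible.eq polys_over_coeff) auto
    ultimately have "{x. lead_coeff p x = 0} \<inter> ?S (p' # ps')
        \<union> {x. lead_coeff p x \<noteq> 0} \<inter> ?S (p # ps') \<in> constructible R"
      by (rule constructible.Un[OF constructible.Int[OF _ _] nz, rotated])
    also have "{x. lead_coeff p x = 0} \<inter> ?S (p' # ps')
        \<union> {x. lead_coeff p x \<noteq> 0} \<inter> ?S (p # ps') = ?S (p # ps')"
      by (auto simp: p'_def)
    finally show ?thesis .
  qed
  \<comment> \<open>Where \<open>lead_coeff a\<close> is nonzero, \<open>b\<close> may be exchanged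
    for the smaller \<open>reduce a b\<close>.\<close>
  have two: "?S (a # b # cs) \<in> constructible R"
    if ab: "a \<noteq> 0" "b \<noteq> 0" "degree a \<le> degree b" "set (a # b # cs) \<subseteq> polys_over R"
      "sum_list (map poly_size (a # b # cs)) = sum_list (map poly_size ps)" for a b cs
  proof (rule split[OF ab(1,4,5)])
    have "?S (a # reduce a b # cs) \<in> constructible R"
      using ab poly_size_reduce[OF ab(2,3)] polys_over_reduce[OF R] by (intro less.hyps) auto
    moreover have "{x. lead_coeff a x \<noteq> 0} \<in> constructible R"
      using ab(4) by (intro constructible.neq polys_over_coeff) auto
    ultimately have "{x. lead_coeff a x \<noteq> 0} \<inter> ?S (a # reduce a b # cs) \<in> constructible R"
      by (rule constructible.Int[rotated])
    also have "{x. lead_coeff a x \<noteq> 0} \<inter> ?S (a # reduce a b # cs)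
        = {x. lead_coeff a x \<noteq> 0} \<inter> ?S (a # b # cs)"
      by (auto simp: reduce_def)
    finally show "{x. lead_coeff a x \<noteq> 0} \<inter> ?S (a # b # cs) \<in> constructible R" .
  qed
  show ?case
  proof (cases "0 \<in> set ps")
    case True
    then obtain us vs where ps: "ps = us @ 0 # vs" by (meson split_list)
    have "?S (us @ vs) \<in> constructible R"
      using less.prems pos[of 0] by (intro less.hyps) (auto simp: ps)
    also have "?S (us @ vs) = ?S ps" by (auto simp: ps)
    finally show ?thesis .
  next
    case nz: False
    consider "ps = []" | p where "ps = [p]" | a b cs where "ps = a # b # cs"
      by (cases ps; cases "tl ps") auto
    then show ?thesis
    proof cases
      case 1
      \<comment> \<open>Without equations, a suitable \<open>t\<close> exists iff the specialized
        \<open>q\<close> is not the zero polynomial, as \<complex> is infinite.\<close>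
      have "?S [] = {x. specialize q x \<noteq> 0}"
        by (auto simp flip: poly_all_0_iff_0)
      then show ?thesis using constructible_specialize_nonzero[OF R q] 1 by simp
    next
      case (2 p)
      have "p \<in> polys_over R" using 2 less.prems by simp
      have "{x. lead_coeff p x \<noteq> 0} \<inter> ?S [p] \<in> constructible R"
        using constructible_root_nonroot[OF R \<open>p \<in> _\<close> q]
        by (simp add: Collect_conj_eq)
      then show ?thesis using split[of p "[]"] nz 2 less.prems by simp
    next
      case (3 a b cs)
      then have ab: "a \<noteq> 0" "b \<noteq> 0" using nz by auto
      show ?thesis
      proof (cases "degree a \<le> degree b")
        case True
        then show ?thesis using two[OF ab True] 3 less.prems by simp
      next
        case False
        then have "?S (b # a # cs) \<in> constructible R"
          by (intro two) (use ab 3 less.prems in auto)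
        also have "?S (b # a # cs) = ?S ps" by (auto simp: 3)
        finally show ?thesis .
      qed
    qed
  qed
qed

lemma poly_funs_cong: "p \<in> poly_funs L \<Longrightarrow> (\<And>l. l \<in> L \<Longrightarrow> l x = l y) \<Longrightarrow> p x = p y"
  by (induction rule: poly_funs.induct) auto

text \<open>The point \<open>u x t\<close> is \<open>x\<close> with its \<open>l\<close>-coordinate
  set to \<open>t\<close>, described only through coordinates so that the point type stays
  arbitrary. Along such a line, a function in \<open>poly_funs (insert l L)\<close> is a polynomial
  in \<open>t\<close> with coefficients from \<open>poly_funs L\<close>.\<close>

lemma constructible_eliminate:
  assumes "C \<in> constructible (poly_funs (insert l L))"
    and u: "\<And>x t. l (u x t) = t" "\<And>x t k. k \<in> L \<Longrightarrow> k (u x t) = k x"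
  shows "{x. \<exists>t. u x t \<in> C} \<in> constructible (poly_funs L)"
proof -
  note R = poly_funs_subring
  obtain bs where bs: "\<forall>(ps, q)\<in>set bs. set ps \<subseteq> poly_funs (insert l L) \<and> q \<in> poly_funs (insert l L)"
    "C = (\<Union>(ps, q)\<in>set bs. basic_set ps q)"
    using constructible_normal_form[OF R assms(1)] by blast
  have "\<forall>f\<in>poly_funs (insert l L). \<exists>P\<in>polys_over (poly_funs L).
      \<forall>x t. f (u x t) = poly (specialize P x) t"
  proof
    fix f assume "f \<in> poly_funs (insert l L)"
    then obtain P where P: "P \<in> polys_over (poly_funs L)" "f = poly P l"
      unfolding poly_funs_insert by blast
    \<comment> \<open>The coefficients of \<open>P\<close> involve only \<open>L\<close>, whose
      values \<open>u\<close> leaves unchanged.\<close>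
    have "specialize P (u x t) = specialize P x" for x t
      using poly_funs_cong[OF polys_over_coeff[OF P(1)], of "u x t" x] u(2) by (auto intro: poly_eqI)
    then show "\<exists>P\<in>polys_over (poly_funs L). \<forall>x t. f (u x t) = poly (specialize P x) t"
      using P u(1) by (intro bexI[of _ P]) (auto simp: poly_fun_apply)
  qed
  then obtain T where T: "\<And>f. f \<in> poly_funs (insert l L) \<Longrightarrow> T f \<in> polys_over (poly_funs L)"
    "\<And>f x t. f \<in> poly_funs (insert l L) \<Longrightarrow> f (u x t) = poly (specialize (T f) x) t"
    by metis
  have "{x. \<exists>t. u x t \<in> basic_set ps q} \<in> constructible (poly_funs L)"
    if "(ps, q) \<in> set bs" for ps q
  proof -
    have m: "set ps \<subseteq> poly_funs (insert l L)" "q \<in> poly_funs (insert l L)" using bs(1) that by auto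
    have "p (u x t) = poly (specialize (T p) x) t" if "p \<in> set ps" for p x t
      using m that T(2) by blast
    moreover have "q (u x t) = poly (specialize (T q) x) t" for x t
      using m T(2) by blast
    ultimately have "{x. \<exists>t. u x t \<in> basic_set ps q}
      = {x. \<exists>t. (\<forall>p\<in>set (map T ps). poly (specialize p x) t = 0) \<and> poly (specialize (T q) x) t \<noteq> 0}"
      by (simp add: basic_set_def)
    also have "\<dots> \<in> constructible (poly_funs L)"
      using m T(1) by (intro constructible_eliminate_basic R) auto
    finally show ?thesis .
  qed
  then have "(\<Union>b\<in>set bs. {x. \<exists>t. u x t \<in> basic_set (fst b) (snd b)}) \<in> constructible (poly_funs L)"
    by (intro constructible_UN R) auto
  also have "(\<Union>b\<in>set bs. {x. \<exists>t. u x t \<in> basic_set (fst b) (snd b)}) = {x. \<exists>t. u x t \<in> C}"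
    unfolding bs(2) by fastforce
  finally show ?thesis .
qed

section \<open>Projection along finitely many parameters\<close>

lemma poly_funs_comp:
  "p \<in> poly_funs L \<Longrightarrow> (\<And>l. l \<in> L \<Longrightarrow> (\<lambda>x. l (h x)) \<in> poly_funs M) \<Longrightarrow> (\<lambda>x. p (h x)) \<in> poly_funs M"
  by (induction rule: poly_funs.induct) (auto intro: poly_funs.intros)

definition coords :: "'j set \<Rightarrow> (('j \<Rightarrow> complex) \<Rightarrow> complex) set" where
  "coords J = (\<lambda>j e. e j) ` J"

text \<open>Chevalley's theorem for projection away from an affine space, by eliminating one
  coordinate after another; the factor carrying \<open>L\<close> stays arbitrary.\<close>

lemma constructible_projection:
  fixes J :: "'j set" and L :: "('x \<Rightarrow> complex) set"
  assumes "finite J" "C \<in> constructible (poly_funs (prod_coords L (coords J)))"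
  shows "{v. \<exists>e. (v, e) \<in> C} \<in> constructible (poly_funs L)"
  using assms
proof (induction J arbitrary: C)
  case empty
  \<comment> \<open>With no coordinate left, membership in \<open>C\<close> does not depend on
    \<open>e\<close>, so any fixed parameter represents the projection; below,
    \<open>undefined\<close> is taken.\<close>
  have "{v. (v, e) \<in> C} \<in> constructible (poly_funs L)
      \<and> (\<forall>v e'. (v, e) \<in> C \<longleftrightarrow> (v, e') \<in> C)" for e
    using empty
  proof induction
    case (eq p)
    have "(\<lambda>v. p (v, e)) \<in> poly_funs L"
      by (rule poly_funs_comp[OF eq]) (auto simp: prod_coords_def coords_def intro: poly_funs.gen)
    then have "{v. (v, e) \<in> {x. p x = 0}} \<in> constructible (poly_funs L)"
      by (simp add: constructible.eq)
    moreover have "p (v, e) = p (v, e')" for v e'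
      by (rule poly_funs_cong[OF eq]) (auto simp: prod_coords_def coords_def)
    then have "(v, e) \<in> {x. p x = 0} \<longleftrightarrow> (v, e') \<in> {x. p x = 0}" for v e'
      by (metis mem_Collect_eq)
    ultimately show ?case by blast
  next
    case (neq p)
    have "(\<lambda>v. p (v, e)) \<in> poly_funs L"
      by (rule poly_funs_comp[OF neq]) (auto simp: prod_coords_def coords_def intro: poly_funs.gen)
    then have "{v. (v, e) \<in> {x. p x \<noteq> 0}} \<in> constructible (poly_funs L)"
      by (simp add: constructible.neq)
    moreover have "p (v, e) = p (v, e')" for v e'
      by (rule poly_funs_cong[OF neq]) (auto simp: prod_coords_def coords_def)
    then have "(v, e) \<in> {x. p x \<noteq> 0} \<longleftrightarrow> (v, e') \<in> {x. p x \<noteq> 0}" for v e'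
      by (metis mem_Collect_eq)
    ultimately show ?case by blast
  next
    case (Un C D)
    have "{v. (v, e) \<in> C \<union> D} = {v. (v, e) \<in> C} \<union> {v. (v, e) \<in> D}" by blast
    with Un show ?case by (auto intro: constructible.Un)
  next
    case (Int C D)
    have "{v. (v, e) \<in> C \<inter> D} = {v. (v, e) \<in> C} \<inter> {v. (v, e) \<in> D}" by blast
    with Int show ?case by (auto intro: constructible.Int)
  qed
  from this[of undefined] have "{v. (v, undefined) \<in> C} \<in> constructible (poly_funs L)"
    and "{v. \<exists>e. (v, e) \<in> C} = {v. (v, undefined) \<in> C}" by blast+
  then show ?case by simp
next
  case (insert j J)
  define u where "u = (\<lambda>(v :: 'x, e :: 'j \<Rightarrow> complex) t. (v, e(j := t)))"
  have "prod_coords L (coords (insert j J)) = insert (\<lambda>z. snd z j) (prod_coords L (coords J))"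
    by (auto simp: prod_coords_def coords_def)
  with insert.prems have "C \<in> constructible (poly_funs (insert (\<lambda>z. snd z j) (prod_coords L (coords J))))"
    by simp
  then have "{z. \<exists>t. u z t \<in> C} \<in> constructible (poly_funs (prod_coords L (coords J)))"
    by (rule constructible_eliminate)
      (use insert.hyps in \<open>auto simp: u_def prod_coords_def coords_def\<close>)
  from insert.IH[OF this] have "{v. \<exists>e t. (v, e(j := t)) \<in> C} \<in> constructible (poly_funs L)"
    by (simp add: u_def)
  \<comment> \<open>Overwriting entry \<open>j\<close> by its own value shows that the extra
    quantifier over \<open>t\<close> changes nothing.\<close>
  moreover have "(\<exists>e t. (v, e(j := t)) \<in> C) \<longleftrightarrow> (\<exists>e. (v, e) \<in> C)" for v
    by (metis fun_upd_triv)
  ultimately show ?case by simp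
qed

section \<open>Zariski closures\<close>

definition vanishing_closure :: "'x set \<Rightarrow> ('x \<Rightarrow> complex) set \<Rightarrow> 'x set \<Rightarrow> 'x set" where
  "vanishing_closure S R A = {x \<in> S. \<forall>p\<in>R. (\<forall>a\<in>A. p a = 0) \<longrightarrow> p x = 0}"

lemma constructible_open_in_closure:
  assumes R: "is_subring R" and "C \<in> constructible R" "S \<inter> C \<noteq> {}"
  shows "\<exists>q\<in>R. (\<exists>a\<in>S \<inter> C. q a \<noteq> 0) \<and>
    (\<forall>x\<in>vanishing_closure S R (S \<inter> C). q x \<noteq> 0 \<longrightarrow> x \<in> C)"
proof -
  obtain bs where bs: "\<forall>(ps, q)\<in>set bs. set ps \<subseteq> R \<and> q \<in> R" "C = (\<Union>(ps, q)\<in>set bs. basic_set ps q)"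
    using constructible_normal_form[OF R assms(2)] by blast
  from bs assms(3) show ?thesis
  proof (induction bs arbitrary: C)
    case (Cons b bs)
    obtain ps q where b: "b = (ps, q)" by (cases b)
    define B where "B = basic_set ps q"
    define D where "D = (\<Union>(ps, q)\<in>set bs. basic_set ps q)"
    have C: "C = B \<union> D" using Cons.prems(2) by (simp add: B_def D_def b)
    show ?case
    proof (cases "S \<inter> B \<subseteq> vanishing_closure S R (S \<inter> D)")
      case True
      \<comment> \<open>The closure of the empty set is empty, since the constant \<open>1\<close>
        is among the functions vanishing on it.\<close>
      have "S \<inter> D \<noteq> {}"
      proof
        assume e: "S \<inter> D = {}"
        then obtain x where "x \<in> S \<inter> B" using Cons.prems(3) C by blast
        with True e is_subringD(1)[OF R] show False
          unfolding vanishing_closure_def by (auto dest!: subsetD bspec[of R _ 1])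
      qed
      then obtain p where p: "p \<in> R" "\<exists>a\<in>S \<inter> D. p a \<noteq> 0"
        "\<forall>x\<in>vanishing_closure S R (S \<inter> D). p x \<noteq> 0 \<longrightarrow> x \<in> D"
        using Cons.IH[of D] Cons.prems(1) D_def by auto
      have "vanishing_closure S R (S \<inter> C) \<subseteq> vanishing_closure S R (S \<inter> D)"
        using True unfolding C vanishing_closure_def by blast
      with p C show ?thesis by blast
    next
      case False
      then obtain y p where y: "y \<in> S" "y \<in> B" "p \<in> R" "\<forall>a\<in>S \<inter> D. p a = 0" "p y \<noteq> 0"
        unfolding vanishing_closure_def by blast
      have m: "set ps \<subseteq> R" "q \<in> R" using Cons.prems(1) b by auto
      have "x \<in> B" if x: "x \<in> vanishing_closure S R (S \<inter> C)" "p x * q x \<noteq> 0" for x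
      proof -
        have "p' x = 0" if "p' \<in> set ps" for p'
        proof -
          \<comment> \<open>On the pieces in \<open>D\<close> the factor \<open>p\<close> vanishes
            and on \<open>B\<close> the factor \<open>p'\<close> does, so the product vanishes on
            the closure; at \<open>x\<close> the factor \<open>p\<close> is nonzero.\<close>
          have "p' * p \<in> R" using m that y is_subringD(6)[OF R] by blast
          moreover have "\<forall>a\<in>S \<inter> C. (p' * p) a = 0"
            using y that by (auto simp: C B_def basic_set_def)
          ultimately have "(p' * p) x = 0" using x unfolding vanishing_closure_def by blast
          with x show ?thesis by simp
        qed
        with x show ?thesis by (simp add: B_def basic_set_def)
      qed
      moreover have "q y \<noteq> 0" using y by (simp add: B_def basic_set_def)
      moreover have "p * q \<in> R" using m y is_subringD(6)[OF R] by blast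
      ultimately show ?thesis using y C by (intro bexI[of _ "p * q"]) auto
    qed
  qed simp
qed

section \<open>Regular functions and closed orbits\<close>

lemma regular_on_const: "regular_on S L (\<lambda>_. c)"
  by (auto simp: regular_on_def intro: poly_funs.const)

lemma regular_on_gen: "l \<in> L \<Longrightarrow> regular_on S L l"
  by (auto simp: regular_on_def intro: poly_funs.gen)

lemma regular_on_add:
  assumes "regular_on S L f" "regular_on S L g"
  shows "regular_on S L (\<lambda>x. f x + g x)"
proof -
  obtain p q where "p \<in> poly_funs L" "\<forall>x\<in>S. f x = p x" "q \<in> poly_funs L" "\<forall>x\<in>S. g x = q x"
    using assms by (auto simp: regular_on_def)
  then show ?thesis using poly_funs.add[of p L q] by (auto simp: regular_on_def)
qed

lemma regular_on_mult:
  assumes "regular_on S L f" "regular_on S L g"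
  shows "regular_on S L (\<lambda>x. f x * g x)"
proof -
  obtain p q where "p \<in> poly_funs L" "\<forall>x\<in>S. f x = p x" "q \<in> poly_funs L" "\<forall>x\<in>S. g x = q x"
    using assms by (auto simp: regular_on_def)
  then show ?thesis using poly_funs.mult[of p L q] by (auto simp: regular_on_def)
qed

lemma regular_on_sum: "(\<And>i. i \<in> I \<Longrightarrow> regular_on S L (f i)) \<Longrightarrow> regular_on S L (\<lambda>x. \<Sum>i\<in>I. f i x)"
  by (induction I rule: infinite_finite_induct) (auto intro: regular_on_const regular_on_add)

lemma regular_on_prod: "(\<And>i. i \<in> I \<Longrightarrow> regular_on S L (f i)) \<Longrightarrow> regular_on S L (\<lambda>x. \<Prod>i\<in>I. f i x)"
  by (induction I rule: infinite_finite_induct) (auto intro: regular_on_const regular_on_mult)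

lemma regular_on_cong: "regular_on S L f \<Longrightarrow> (\<And>x. x \<in> S \<Longrightarrow> f x = g x) \<Longrightarrow> regular_on S L g"
  by (auto simp: regular_on_def)

lemma regular_on_mono: "regular_on S L f \<Longrightarrow> S' \<subseteq> S \<Longrightarrow> L \<subseteq> L' \<Longrightarrow> regular_on S' L' f"
  using poly_funs_mono[of L L'] unfolding regular_on_def by blast

lemma regular_on_poly_funs_comp:
  assumes "p \<in> poly_funs L" "\<And>l. l \<in> L \<Longrightarrow> regular_on S M (\<lambda>x. l (h x))"
  shows "regular_on S M (\<lambda>x. p (h x))"
  using assms
  by (induction rule: poly_funs.induct)
    (auto intro: regular_on_const regular_on_add regular_on_mult)

lemma regular_on_comp:
  assumes "regular_on T L f" "\<And>x. x \<in> S \<Longrightarrow> h x \<in> T" "\<And>l. l \<in> L \<Longrightarrow> regular_on S M (\<lambda>x. l (h x))"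
  shows "regular_on S M (\<lambda>x. f (h x))"
proof -
  obtain p where p: "p \<in> poly_funs L" "\<forall>x\<in>T. f x = p x" using assms(1) by (auto simp: regular_on_def)
  show ?thesis
    by (rule regular_on_cong[OF regular_on_poly_funs_comp[OF p(1) assms(3)]]) (use p(2) assms(2) in auto)
qed

lemma regular_on_coord: "j \<in> J \<Longrightarrow> regular_on E (coords J) (\<lambda>e. e j)"
  by (auto simp: coords_def intro!: regular_on_gen)

text \<open>A regular image of a closed subset of affine space with finitely many coordinates. A
  quantifier over the elements of a group then becomes one over complex parameters, which
  elimination can remove.\<close>

definition param_by ::
    "'j set \<Rightarrow> ('j \<Rightarrow> complex) set \<Rightarrow> (('j \<Rightarrow> complex) \<Rightarrow> 'g) \<Rightarrow> 'g set \<Rightarrow> ('g \<Rightarrow> complex) set \<Rightarrow> bool" where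
  "param_by J E \<pi> C M \<longleftrightarrow>
     finite J \<and> (\<exists>Q\<subseteq>poly_funs (coords J). E = {e. \<forall>q\<in>Q. q e = 0}) \<and> \<pi> ` E = C \<and>
     (\<forall>l\<in>M. regular_on E (coords J) (\<lambda>e. l (\<pi> e)))"

text \<open>Parameter vectors are concatenated, with indices tagged by \<open>Inl\<close> and
  \<open>Inr\<close>.\<close>

lemma param_by_prod:
  fixes J1 :: "'j set" and J2 :: "'k set"
  assumes "param_by J1 E1 \<pi>1 C1 M1" "param_by J2 E2 \<pi>2 C2 M2"
  shows "param_by (J1 <+> J2) {e. e \<circ> Inl \<in> E1 \<and> e \<circ> Inr \<in> E2}
    (\<lambda>e. (\<pi>1 (e \<circ> Inl), \<pi>2 (e \<circ> Inr))) (C1 \<times> C2) (prod_coords M1 M2)"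
proof -
  let ?J = "J1 <+> J2" and ?E = "{e. e \<circ> Inl \<in> E1 \<and> e \<circ> Inr \<in> E2}"
    and ?\<pi> = "\<lambda>e. (\<pi>1 (e \<circ> Inl), \<pi>2 (e \<circ> Inr))"
  obtain Q1 where Q1: "Q1 \<subseteq> poly_funs (coords J1)" "E1 = {e. \<forall>q\<in>Q1. q e = 0}"
    using assms(1) unfolding param_by_def by blast
  obtain Q2 where Q2: "Q2 \<subseteq> poly_funs (coords J2)" "E2 = {e. \<forall>q\<in>Q2. q e = 0}"
    using assms(2) unfolding param_by_def by blast
  define Q where "Q = (\<lambda>q e. q (e \<circ> Inl)) ` Q1 \<union> (\<lambda>q e. q (e \<circ> Inr)) ` Q2"
  have "(\<lambda>e. q (e \<circ> Inl)) \<in> poly_funs (coords ?J)" if "q \<in> Q1" for q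
    by (rule poly_funs_comp[OF subsetD[OF Q1(1) that]])
      (auto simp: coords_def intro!: poly_funs.gen)
  moreover have "(\<lambda>e. q (e \<circ> Inr)) \<in> poly_funs (coords ?J)" if "q \<in> Q2" for q
    by (rule poly_funs_comp[OF subsetD[OF Q2(1) that]])
      (auto simp: coords_def intro!: poly_funs.gen)
  ultimately have "Q \<subseteq> poly_funs (coords ?J)" unfolding Q_def by blast
  moreover have "?E = {e. \<forall>q\<in>Q. q e = 0}" unfolding Q_def Q1(2) Q2(2) by auto
  moreover have "?\<pi> ` ?E = C1 \<times> C2"
  proof (intro equalityI subsetI)
    fix z assume "z \<in> C1 \<times> C2"
    then obtain e1 e2 where e: "e1 \<in> E1" "e2 \<in> E2" "z = (\<pi>1 e1, \<pi>2 e2)"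
      using assms unfolding param_by_def by (auto simp: image_iff)
    have "case_sum e1 e2 \<circ> Inl = e1" "case_sum e1 e2 \<circ> Inr = e2" by auto
    with e show "z \<in> ?\<pi> ` ?E" by (intro image_eqI[of _ _ "case_sum e1 e2"]) auto
  qed (use assms in \<open>auto simp: param_by_def\<close>)
  moreover have "regular_on ?E (coords ?J) (\<lambda>e. l (?\<pi> e))" if l: "l \<in> prod_coords M1 M2" for l
  proof -
    consider k where "k \<in> M1" "l = (\<lambda>z. k (fst z))" | k where "k \<in> M2" "l = (\<lambda>z. k (snd z))"
      using l by (auto simp: prod_coords_def)
    then show ?thesis
    proof cases
      case 1
      then have "regular_on E1 (coords J1) (\<lambda>e. k (\<pi>1 e))" using assms(1) by (simp add: param_by_def)
      then have "regular_on ?E (coords ?J) (\<lambda>e. k (\<pi>1 (e \<circ> Inl)))"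
        by (rule regular_on_comp) (auto simp: coords_def intro!: regular_on_gen)
      then show ?thesis by (simp add: 1)
    next
      case 2
      then have "regular_on E2 (coords J2) (\<lambda>e. k (\<pi>2 e))" using assms(2) by (simp add: param_by_def)
      then have "regular_on ?E (coords ?J) (\<lambda>e. k (\<pi>2 (e \<circ> Inr)))"
        by (rule regular_on_comp) (auto simp: coords_def intro!: regular_on_gen)
      then show ?thesis by (simp add: 2)
    qed
  qed
  moreover have "finite ?J" using assms by (simp add: param_by_def)
  ultimately show ?thesis unfolding param_by_def by blast
qed

text \<open>Closed conditions pull back along \<open>\<pi>\<close> to polynomial conditions on the
  parameters; this passes from \<open>GL N\<close> to a closed subgroup.\<close>

lemma param_by_closed:
  assumes "param_by J E \<pi> C M" "P \<subseteq> poly_funs M"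
  shows "param_by J {e \<in> E. \<forall>p\<in>P. p (\<pi> e) = 0} \<pi> {g \<in> C. \<forall>p\<in>P. p g = 0} M"
proof -
  obtain Q where Q: "Q \<subseteq> poly_funs (coords J)" "E = {e. \<forall>q\<in>Q. q e = 0}"
    using assms(1) unfolding param_by_def by blast
  have "\<forall>p\<in>P. \<exists>q\<in>poly_funs (coords J). \<forall>e\<in>E. p (\<pi> e) = q e"
    using assms regular_on_poly_funs_comp[of _ M E "coords J" \<pi>]
    unfolding param_by_def regular_on_def by blast
  then obtain T where T: "\<And>p. p \<in> P \<Longrightarrow> T p \<in> poly_funs (coords J)"
    "\<And>p e. p \<in> P \<Longrightarrow> e \<in> E \<Longrightarrow> p (\<pi> e) = T p e" by metis
  have "{e \<in> E. \<forall>p\<in>P. p (\<pi> e) = 0} = {e. \<forall>q\<in>Q \<union> T ` P. q e = 0}"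
    unfolding Q(2) using T(2)[unfolded Q(2)] by (auto simp: ball_Un)
  moreover have "Q \<union> T ` P \<subseteq> poly_funs (coords J)" using Q(1) T(1) by blast
  ultimately have "\<exists>Q\<subseteq>poly_funs (coords J). {e \<in> E. \<forall>p\<in>P. p (\<pi> e) = 0} = {e. \<forall>q\<in>Q. q e = 0}"
    by blast
  then show ?thesis
    using assms(1) unfolding param_by_def by (auto intro: regular_on_mono)
qed

section \<open>The general linear group as an affine variety\<close>

lemma GL_carrier: "A \<in> carrier (GL n) \<longleftrightarrow> A \<in> carrier_mat n n \<and> det A \<noteq> 0"
proof -
  have 1: "carrier (GL n) = Units (ring_mat TYPE(complex) n ())"
    by (simp add: GL_def units_of_def)
  show ?thesis
  proof
    assume A: "A \<in> carrier (GL n)"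
    then have "A \<in> carrier_mat n n" unfolding 1 Units_def ring_mat_def by simp
    with A show "A \<in> carrier_mat n n \<and> det A \<noteq> 0"
      unfolding 1 using unit_imp_det_non_zero by metis
  next
    assume "A \<in> carrier_mat n n \<and> det A \<noteq> 0"
    then show "A \<in> carrier (GL n)" unfolding 1 by (intro det_non_zero_imp_unit) auto
  qed
qed

lemma GL_simps [simp]: "A \<otimes>\<^bsub>GL n\<^esub> B = A * B" "\<one>\<^bsub>GL n\<^esub> = 1\<^sub>m n"
  by (simp_all add: GL_def units_of_def ring_mat_def)

lemma group_GL: "group (GL n)"
proof -
  interpret ring "ring_mat TYPE(complex) n ()" by (rule ring_mat)
  show ?thesis unfolding GL_def by (rule units_group)
qed

text \<open>Matrix-valued morphisms, entry by entry; the dimensions are recorded because the matrix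
  type contains all sizes.\<close>

definition regular_mat ::
    "'x set \<Rightarrow> ('x \<Rightarrow> complex) set \<Rightarrow> nat \<Rightarrow> nat \<Rightarrow> ('x \<Rightarrow> complex mat) \<Rightarrow> bool" where
  "regular_mat S M r c A \<longleftrightarrow> (\<forall>x\<in>S. A x \<in> carrier_mat r c) \<and>
     (\<forall>i<r. \<forall>j<c. regular_on S M (\<lambda>x. A x $$ (i, j)))"

lemma regular_matD:
  assumes "regular_mat S M r c A"
  shows "x \<in> S \<Longrightarrow> A x \<in> carrier_mat r c"
    "i < r \<Longrightarrow> j < c \<Longrightarrow> regular_on S M (\<lambda>x. A x $$ (i, j))"
  using assms by (simp_all add: regular_mat_def)

lemma regular_mat_const: "B \<in> carrier_mat r c \<Longrightarrow> regular_mat S M r c (\<lambda>_. B)"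
  by (simp add: regular_mat_def regular_on_const)

lemma regular_mat_mult:
  assumes A: "regular_mat S M r k A" and B: "regular_mat S M k c B"
  shows "regular_mat S M r c (\<lambda>x. A x * B x)"
  unfolding regular_mat_def
proof (intro conjI ballI allI impI)
  show "A x * B x \<in> carrier_mat r c" if "x \<in> S" for x
    using regular_matD(1)[OF A that] regular_matD(1)[OF B that] by simp
  fix i j assume ij: "i < r" "j < c"
  have "regular_on S M (\<lambda>x. \<Sum>l\<in>{0..<k}. A x $$ (i, l) * B x $$ (l, j))"
    by (intro regular_on_sum regular_on_mult regular_matD(2)[OF A] regular_matD(2)[OF B]) (use ij in auto)
  then show "regular_on S M (\<lambda>x. (A x * B x) $$ (i, j))"
  proof (rule regular_on_cong)
    fix x assume "x \<in> S"
    then show "(\<Sum>l\<in>{0..<k}. A x $$ (i, l) * B x $$ (l, j)) = (A x * B x) $$ (i, j)"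
      using regular_matD(1)[OF A, of x] regular_matD(1)[OF B, of x] ij by (simp add: scalar_prod_def)
  qed
qed

lemma regular_mat_transpose:
  assumes A: "regular_mat S M r c A"
  shows "regular_mat S M c r (\<lambda>x. (A x)\<^sup>T)"
  unfolding regular_mat_def
proof (intro conjI ballI allI impI)
  show "(A x)\<^sup>T \<in> carrier_mat c r" if "x \<in> S" for x
    using regular_matD(1)[OF A that] by simp
  fix i j assume ij: "i < c" "j < r"
  have "(A x) $$ (j, i) = (A x)\<^sup>T $$ (i, j)" if "x \<in> S" for x
    using regular_matD(1)[OF A that] ij by simp
  then show "regular_on S M (\<lambda>x. (A x)\<^sup>T $$ (i, j))"
    by (rule regular_on_cong[OF regular_matD(2)[OF A ij(2,1)]])
qed

lemma regular_mat_det: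
  assumes A: "regular_mat S M n n A"
  shows "regular_on S M (\<lambda>x. det (A x))"
proof -
  have "regular_on S M (\<lambda>x. \<Sum>p\<in>{p. p permutes {0..<n}}. signof p * (\<Prod>i = 0..<n. A x $$ (i, p i)))"
    by (intro regular_on_sum regular_on_mult regular_on_const regular_on_prod regular_matD(2)[OF A])
      (auto dest: permutes_in_image)
  then show ?thesis
  proof (rule regular_on_cong)
    fix x assume "x \<in> S"
    show "(\<Sum>p\<in>{p. p permutes {0..<n}}. signof p * (\<Prod>i = 0..<n. A x $$ (i, p i))) = det (A x)"
      by (rule det_def'[symmetric]) (rule regular_matD(1)[OF A \<open>x \<in> S\<close>])
  qed
qed

lemma regular_mat_delete:
  assumes A: "regular_mat S M n n A"
  shows "regular_mat S M (n - 1) (n - 1) (\<lambda>x. mat_delete (A x) k l)"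
  unfolding regular_mat_def
proof (intro conjI ballI allI impI)
  show "mat_delete (A x) k l \<in> carrier_mat (n - 1) (n - 1)" if "x \<in> S" for x
    using regular_matD(1)[OF A that] by (rule mat_delete_carrier)
  fix i j assume ij: "i < n - 1" "j < n - 1"
  let ?i = "if i < k then i else Suc i" and ?j = "if j < l then j else Suc j"
  have "regular_on S M (\<lambda>x. A x $$ (?i, ?j))"
    by (rule regular_matD(2)[OF A]) (use ij in auto)
  then show "regular_on S M (\<lambda>x. mat_delete (A x) k l $$ (i, j))"
  proof (rule regular_on_cong)
    fix x assume "x \<in> S"
    then show "A x $$ (?i, ?j) = mat_delete (A x) k l $$ (i, j)"
      using regular_matD(1)[OF A, of x] ij by (simp add: mat_delete_def)
  qed
qed

text \<open>The inverse determinant becomes a coordinate of its own, at index \<open>None\<close>: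
  invertibility turns into the closed condition t det A = 1, and the generator
  \<open>inverse (det A)\<close> into a polynomial.\<close>

lemma param_by_GL:
  "param_by (insert None (Some ` ({..<n} \<times> {..<n}))) {e. e None * det (mat n n (\<lambda>ij. e (Some ij))) = 1}
    (\<lambda>e. mat n n (\<lambda>ij. e (Some ij))) (carrier (GL n)) (GL_coords n)"
proof -
  let ?J = "insert None (Some ` ({..<n} \<times> {..<n}))" and ?\<pi> = "\<lambda>e. mat n n (\<lambda>ij. e (Some ij))"
  let ?E = "{e. e None * det (?\<pi> e) = 1}"
  have "regular_mat UNIV (coords ?J) n n ?\<pi>"
    by (auto simp: regular_mat_def intro!: regular_on_coord)
  then have "regular_on UNIV (coords ?J) (\<lambda>e. det (?\<pi> e))"
    by (rule regular_mat_det)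
  then have "regular_on UNIV (coords ?J) (\<lambda>e. e None * det (?\<pi> e) + (- 1))"
    by (intro regular_on_add regular_on_mult regular_on_const regular_on_coord) auto
  then obtain q where q: "q \<in> poly_funs (coords ?J)" "\<And>e. q e = e None * det (?\<pi> e) + (- 1)"
    by (auto simp: regular_on_def)
  have "?E = {e. \<forall>q\<in>{q}. q e = 0}" by (auto simp: q(2))
  with q(1) have "\<exists>Q\<subseteq>poly_funs (coords ?J). ?E = {e. \<forall>q\<in>Q. q e = 0}" by blast
  moreover have "?\<pi> ` ?E = carrier (GL n)"
  proof (intro equalityI subsetI)
    fix A assume A: "A \<in> carrier (GL n)"
    define e where "e = case_option (inverse (det A)) (\<lambda>ij. A $$ ij)"
    have "?\<pi> e = A" using A by (auto simp: GL_carrier e_def)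
    moreover have "e None = inverse (det A)" by (simp add: e_def)
    ultimately show "A \<in> ?\<pi> ` ?E" using A by (intro image_eqI[of _ _ e]) (auto simp: GL_carrier)
  qed (auto simp: GL_carrier)
  moreover have "regular_on ?E (coords ?J) (\<lambda>e. l (?\<pi> e))" if l: "l \<in> GL_coords n" for l
  proof -
    consider "l = (\<lambda>A. inverse (det A))" | i j where "i < n" "j < n" "l = (\<lambda>A. A $$ (i, j))"
      using l by (auto simp: GL_coords_def mat_coords_def)
    then show ?thesis
    proof cases
      case 1
      have "regular_on ?E (coords ?J) (\<lambda>e. e None)" by (rule regular_on_coord) simp
      then show ?thesis by (rule regular_on_cong) (auto simp: 1 inverse_unique mult.commute)
    next
      case (2 i j)
      have "regular_on ?E (coords ?J) (\<lambda>e. e (Some (i, j)))" by (rule regular_on_coord) (use 2 in auto)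
      then show ?thesis by (rule regular_on_cong) (simp add: 2)
    qed
  qed
  moreover have "finite ?J" by simp
  ultimately show ?thesis unfolding param_by_def by blast
qed

text \<open>Constructible sets allow only finitely many conditions, whereas a closed set may be
  given by infinitely many equations; finite generation of their ideal bridges the two.\<close>

lemma noetherian_finite_zero_set:
  assumes R: "is_subring R" "noetherian R" and "P \<subseteq> R"
  shows "\<exists>B\<subseteq>R. finite B \<and> {x. \<forall>p\<in>P. p x = 0} = {x :: 'x. \<forall>b\<in>B. b x = (0 :: complex)}"
proof -
  obtain B where B: "B \<subseteq> ideal_gen R P" "finite B" "ideal_gen R P \<subseteq> ideal_gen R B"
    using R(2) is_ideal_ideal_gen[OF R(1) assms(3)] unfolding noetherian_def by blast
  have v: "s x = 0" if "s \<in> ideal_gen R X" "\<forall>p\<in>X. p x = 0" for s X x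
    using that by induction auto
  have "B \<subseteq> R" using B(1) is_ideal_ideal_gen[OF R(1) assms(3)] by (auto simp: is_ideal_def)
  moreover have "{x. \<forall>p\<in>P. p x = 0} = {x. \<forall>b\<in>B. b x = 0}"
  proof (intro Collect_cong iffI ballI)
    fix x b assume "\<forall>p\<in>P. p x = 0" "b \<in> B"
    then show "b x = 0" using v[of b P x] B(1) by auto
  next
    fix x p assume "\<forall>b\<in>B. b x = 0" "p \<in> P"
    then show "p x = 0" using v[of p B x] B(3) ideal_gen_base[OF R(1), of p P] by auto
  qed
  ultimately show ?thesis using B(2) by blast
qed

text \<open>The vanishing ideals of a descending chain of closures ascend, and their union is
  finitely generated. Once the ideals stop growing, the closures stop shrinking, because a closure
  is the zero set of its ideal.\<close>

lemma noetherian_no_descending_closures: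
  assumes R: "is_subring R" "noetherian R"
  shows "\<not> (\<forall>i::nat. vanishing_closure S R (A (Suc i)) \<subset> vanishing_closure S R (A i))"
proof
  let ?Z = "\<lambda>i. vanishing_closure S R (A i)"
  assume desc: "\<forall>i. ?Z (Suc i) \<subset> ?Z i"
  have anti: "?Z j \<subseteq> ?Z i" if "i \<le> j" for i j
    by (rule lift_Suc_antimono_le[of ?Z, OF psubset_imp_subset[OF desc[rule_format]] that])
  define I where "I i = {p \<in> R. \<forall>x\<in>?Z i. p x = 0}" for i
  have I_mono: "I i \<subseteq> I j" if "i \<le> j" for i j using anti[OF that] by (auto simp: I_def)
  have ideal: "is_ideal R (I i)" for i
    using is_subringD[OF R(1)] by (auto simp: is_ideal_def I_def)
  have "is_ideal R (\<Union>i. I i)"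
    unfolding is_ideal_def
  proof (intro conjI ballI)
    fix a b assume "a \<in> (\<Union>i. I i)" "b \<in> (\<Union>i. I i)"
    then obtain i j where "a \<in> I i" "b \<in> I j" by blast
    then have "a \<in> I (max i j)" "b \<in> I (max i j)"
      using I_mono[of i "max i j"] I_mono[of j "max i j"] by auto
    then have "a + b \<in> I (max i j)" using ideal[of "max i j"] by (simp add: is_ideal_def)
    then show "a + b \<in> (\<Union>i. I i)" by blast
  next
    fix r a assume "r \<in> R" "a \<in> (\<Union>i. I i)"
    then obtain i where "a \<in> I i" by blast
    then have "r * a \<in> I i" using \<open>r \<in> R\<close> ideal[of i] by (simp add: is_ideal_def)
    then show "r * a \<in> (\<Union>i. I i)" by blast
  next
    show "(\<Union>i. I i) \<subseteq> R" by (auto simp: I_def)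
    have "0 \<in> I 0" using ideal[of 0] by (simp add: is_ideal_def)
    then show "0 \<in> (\<Union>i. I i)" by blast
  qed
  then obtain B where B: "B \<subseteq> (\<Union>i. I i)" "finite B" "(\<Union>i. I i) \<subseteq> ideal_gen R B"
    using R(2)[unfolded noetherian_def, rule_format, of "\<Union>i. I i"] by metis
  from B(2,1) have "\<exists>n. B \<subseteq> I n"
  proof (induction B)
    case (insert b B)
    then obtain i j where "B \<subseteq> I i" "b \<in> I j" by auto
    then have "insert b B \<subseteq> I (max i j)"
      using I_mono[of i "max i j"] I_mono[of j "max i j"] by auto
    then show ?case by blast
  qed simp
  then obtain n where "B \<subseteq> I n" ..
  then have "ideal_gen R B \<subseteq> I n" by (rule ideal_gen_subset[OF ideal])
  then have "(\<Union>i. I i) \<subseteq> I n" using B(3) by (rule subset_trans[rotated])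
  then have "I (Suc n) \<subseteq> I n" by blast
  \<comment> \<open>Only functions vanishing on \<open>A (Suc n)\<close> have to be tested; they
    vanish on its closure, so they belong to \<open>I (Suc n)\<close> and hence to
    \<open>I n\<close>.\<close>
  have "?Z n \<subseteq> ?Z (Suc n)"
  proof
    fix x assume x: "x \<in> ?Z n"
    have "p x = 0" if "p \<in> R" "\<forall>a\<in>A (Suc n). p a = 0" for p
    proof -
      have "p \<in> I (Suc n)" using that by (auto simp: I_def vanishing_closure_def)
      with \<open>I (Suc n) \<subseteq> I n\<close> have "p \<in> I n" by (rule subsetD)
      with x show ?thesis by (simp add: I_def)
    qed
    with x show "x \<in> ?Z (Suc n)" by (simp add: vanishing_closure_def)
  qed
  with desc[rule_format, of n] show False by (simp add: less_le_not_le)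
qed

text \<open>Regularity is asked separately: in the group element for a fixed point, which makes
  orbits constructible, and in the point for a fixed group element, which makes translations
  continuous. \<open>L\<close> is the natural, possibly infinite, set of coordinates;
  \<open>L0\<close> generates the same ring, is finite for the sake of Hilbert's theorem and
  elimination, and separates points.\<close>

locale algebraic_action =
  fixes \<Gamma> :: "('g, 'b) monoid_scheme" and M :: "('g \<Rightarrow> complex) set"
    and J :: "'j set" and E :: "('j \<Rightarrow> complex) set" and \<pi> :: "('j \<Rightarrow> complex) \<Rightarrow> 'g"
    and act :: "'g \<Rightarrow> 'x \<Rightarrow> 'x" and S :: "'x set" and L L0 :: "('x \<Rightarrow> complex) set"
  assumes group: "group \<Gamma>" and param: "param_by J E \<pi> (carrier \<Gamma>) M"
    and finite_L0: "finite L0" and poly_funs_L0: "poly_funs L0 = poly_funs L"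
    and separating: "\<And>x y. x \<in> S \<Longrightarrow> y \<in> S \<Longrightarrow> (\<And>l. l \<in> L0 \<Longrightarrow> l x = l y) \<Longrightarrow> x = y"
    and act_closed: "\<And>g x. g \<in> carrier \<Gamma> \<Longrightarrow> x \<in> S \<Longrightarrow> act g x \<in> S"
    and act_one: "\<And>x. x \<in> S \<Longrightarrow> act \<one>\<^bsub>\<Gamma>\<^esub> x = x"
    and act_mult: "\<And>g h x. g \<in> carrier \<Gamma> \<Longrightarrow> h \<in> carrier \<Gamma> \<Longrightarrow> x \<in> S \<Longrightarrow>
      act (g \<otimes>\<^bsub>\<Gamma>\<^esub> h) x = act g (act h x)"
    and regular_group: "\<And>x l. x \<in> S \<Longrightarrow> l \<in> L \<Longrightarrow> regular_on (carrier \<Gamma>) M (\<lambda>g. l (act g x))"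
    and regular_space: "\<And>g l. g \<in> carrier \<Gamma> \<Longrightarrow> l \<in> L \<Longrightarrow> regular_on S L (\<lambda>x. l (act g x))"
begin

abbreviation "R \<equiv> poly_funs L"
abbreviation "orb x \<equiv> Group_Action.orbit \<Gamma> act x"
abbreviation "cl A \<equiv> vanishing_closure S R A"

section \<open>Orbits and their closures\<close>

lemma orb_eq: "orb x = {act g x | g. g \<in> carrier \<Gamma>}"
  by (simp add: Group_Action.orbit_def)

lemma noetherian_R: "noetherian R"
  using noetherian_poly_funs[OF finite_L0] by (simp add: poly_funs_L0)

lemma L0_subset: "L0 \<subseteq> R"
  unfolding poly_funs_L0[symmetric] by (auto intro: poly_funs.gen)

lemma orb_subset: "x \<in> S \<Longrightarrow> orb x \<subseteq> S"
  by (auto simp: orb_eq act_closed)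

lemma orbI: "g \<in> carrier \<Gamma> \<Longrightarrow> act g x \<in> orb x"
  by (auto simp: orb_eq)

lemma orbE:
  assumes "y \<in> orb x"
  obtains g where "g \<in> carrier \<Gamma>" "y = act g x"
  using assms by (auto simp: orb_eq)

lemma orb_self:
  assumes "x \<in> S"
  shows "x \<in> orb x"
  using orbI[OF monoid.one_closed[OF group.is_monoid[OF group]], of x] act_one[OF assms] by simp

lemma orb_act:
  assumes "x \<in> S" "y \<in> orb x" "g \<in> carrier \<Gamma>"
  shows "act g y \<in> orb x"
proof -
  obtain h where h: "h \<in> carrier \<Gamma>" "y = act h x" using assms(2) by (rule orbE)
  have "g \<otimes>\<^bsub>\<Gamma>\<^esub> h \<in> carrier \<Gamma>"
    using assms(3) h(1) monoid.m_closed[OF group.is_monoid[OF group]] by simp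
  from orbI[OF this, of x] show ?thesis using act_mult[OF assms(3) h(1) assms(1)] h(2) by simp
qed

lemma orb_act_iff:
  assumes "x \<in> S" "y \<in> S" "g \<in> carrier \<Gamma>"
  shows "act g y \<in> orb x \<longleftrightarrow> y \<in> orb x"
proof
  interpret group \<Gamma> by (rule group)
  assume "act g y \<in> orb x"
  from orb_act[OF assms(1) this inv_closed[OF assms(3)]] show "y \<in> orb x"
    using act_mult[OF inv_closed[OF assms(3)] assms(3,2)] act_one[OF assms(2)] assms(3) by simp
next
  assume "y \<in> orb x"
  then show "act g y \<in> orb x" using assms orb_act by simp
qed

lemma orb_eqI:
  assumes "x \<in> S" "y \<in> orb x"
  shows "orb y = orb x"
proof
  have yS: "y \<in> S" using assms orb_subset by blast
  obtain g where g: "g \<in> carrier \<Gamma>" "y = act g x" using assms(2) by (rule orbE)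
  have x: "x \<in> orb y" using orb_act_iff[OF yS assms(1) g(1)] g(2) orb_self[OF yS] by simp
  show "orb x \<subseteq> orb y"
  proof
    fix z assume "z \<in> orb x"
    then show "z \<in> orb y" using orb_act[OF yS x] by (auto elim: orbE)
  qed
  show "orb y \<subseteq> orb x"
  proof
    fix z assume "z \<in> orb y"
    then show "z \<in> orb x" using orb_act[OF assms] by (auto elim: orbE)
  qed
qed

text \<open>The orbit is the projection of the graph of \<open>e \<mapsto> act (\<pi> e) x\<close>,
  which finitely many equations describe: those of \<open>E\<close>, and equality of all coordinates
  in \<open>L0\<close>.\<close>

lemma constructible_orb:
  assumes x: "x \<in> S"
  shows "\<exists>C\<in>constructible R. orb x = S \<inter> C"
proof -
  obtain Q where Q: "Q \<subseteq> poly_funs (coords J)" "E = {e. \<forall>q\<in>Q. q e = 0}"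
    using param unfolding param_by_def by blast
  have "finite J" using param by (simp add: param_by_def)
  then have "noetherian (poly_funs (coords J))"
    by (intro noetherian_poly_funs) (simp add: coords_def)
  then obtain B where B: "B \<subseteq> poly_funs (coords J)" "finite B" "E = {e. \<forall>q\<in>B. q e = 0}"
    using noetherian_finite_zero_set[OF poly_funs_subring _ Q(1)] unfolding Q(2) by blast
  have "\<exists>p\<in>poly_funs (coords J). \<forall>e\<in>E. l (act (\<pi> e) x) = p e" if "l \<in> L0" for l
  proof -
    have l: "l \<in> R" using that L0_subset by blast
    have "regular_on (carrier \<Gamma>) M (\<lambda>g. l (act g x))"
      by (rule regular_on_poly_funs_comp[OF l regular_group[OF x]])
    then have "regular_on E (coords J) (\<lambda>e. l (act (\<pi> e) x))"
      by (rule regular_on_comp) (use param in \<open>auto simp: param_by_def\<close>)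
    then show ?thesis by (simp add: regular_on_def)
  qed
  then obtain T where T: "\<And>l. l \<in> L0 \<Longrightarrow> T l \<in> poly_funs (coords J)"
    "\<And>l e. l \<in> L0 \<Longrightarrow> e \<in> E \<Longrightarrow> l (act (\<pi> e) x) = T l e" by metis
  let ?P = "poly_funs (prod_coords L (coords J))"
  \<comment> \<open>\<open>T l e\<close> is the coordinate \<open>l\<close> of the point
    \<open>act (\<pi> e) x\<close>, written as a polynomial in the parameters.\<close>
  define D where "D = (\<Inter>q\<in>B. {z. q (snd z) = 0}) \<inter> (\<Inter>l\<in>L0. {z. l (fst z) + (- 1) * T l (snd z) = 0})"
  have 1: "(\<lambda>z. q (snd z)) \<in> ?P" if "q \<in> poly_funs (coords J)" for q :: "_ \<Rightarrow> complex"
    by (rule poly_funs_comp[OF that]) (auto simp: prod_coords_def intro: poly_funs.gen)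
  have 2: "(\<lambda>z. l (fst z)) \<in> ?P" if "l \<in> R" for l
    by (rule poly_funs_comp[OF that]) (auto simp: prod_coords_def intro: poly_funs.gen)
  have "{z. q (snd z) = 0} \<in> constructible ?P" if "q \<in> B" for q
    using 1[of q] B(1) that by (intro constructible.eq) auto
  moreover have "{z. l (fst z) + (- 1) * T l (snd z) = 0} \<in> constructible ?P" if "l \<in> L0" for l
  proof -
    have "(\<lambda>z. (- 1) * T l (snd z)) \<in> ?P"
      by (rule poly_funs.mult[OF poly_funs.const 1[OF T(1)[OF that]]])
    from poly_funs.add[OF 2[OF subsetD[OF L0_subset that]] this] show ?thesis
      by (rule constructible.eq)
  qed
  ultimately have "D \<in> constructible ?P"
    unfolding D_def
    by (intro constructible.Int constructible_INT poly_funs_subring B(2) finite_L0)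
  then have "{v. \<exists>e. (v, e) \<in> D} \<in> constructible R"
    by (rule constructible_projection[OF \<open>finite J\<close>])
  moreover have "orb x = S \<inter> {v. \<exists>e. (v, e) \<in> D}"
  proof (intro equalityI subsetI)
    fix v assume v: "v \<in> orb x"
    then obtain g where g: "g \<in> carrier \<Gamma>" "v = act g x" by (rule orbE)
    have "carrier \<Gamma> = \<pi> ` E" using param by (simp add: param_by_def)
    with g(1) have "g \<in> \<pi> ` E" by simp
    then obtain e where "e \<in> E" "v = act (\<pi> e) x" using g(2) by (auto elim: imageE)
    then have "(v, e) \<in> D" using T(2) B(3) by (auto simp: D_def)
    then show "v \<in> S \<inter> {v. \<exists>e. (v, e) \<in> D}" using orb_subset[OF x] v by blast
  next
    fix v assume "v \<in> S \<inter> {v. \<exists>e. (v, e) \<in> D}"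
    then obtain e where v: "v \<in> S" "(v, e) \<in> D" by blast
    then have e: "e \<in> E" unfolding B(3) by (auto simp: D_def)
    then have g: "\<pi> e \<in> carrier \<Gamma>" using param by (auto simp: param_by_def)
    \<comment> \<open>Coordinates separate points only inside \<open>S\<close>, which is why the
      projection is intersected with \<open>S\<close>.\<close>
    have "v = act (\<pi> e) x"
      using v T(2)[OF _ e] by (intro separating act_closed g x) (auto simp: D_def)
    with g show "v \<in> orb x" by (auto simp: orb_eq)
  qed
  ultimately show ?thesis by blast
qed

text \<open>Translation by \<open>g\<close> is a regular map preserving the orbit, so a function
  vanishing on the orbit pulls back to another such function.\<close>

lemma cl_orb_act:
  assumes "x \<in> S" "y \<in> cl (orb x)" "g \<in> carrier \<Gamma>"
  shows "act g y \<in> cl (orb x)"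
proof -
  have yS: "y \<in> S" using assms by (simp add: vanishing_closure_def)
  have "p (act g y) = 0" if p: "p \<in> R" "\<forall>a\<in>orb x. p a = 0" for p
  proof -
    have "regular_on S L (\<lambda>x. p (act g x))"
      by (rule regular_on_poly_funs_comp[OF p(1)]) (rule regular_space[OF assms(3)])
    then obtain q where q: "q \<in> R" "\<And>x. x \<in> S \<Longrightarrow> p (act g x) = q x"
      by (auto simp: regular_on_def)
    have "q a = 0" if "a \<in> orb x" for a
      using p(2) orb_act[OF assms(1) that assms(3)] q(2)[of a] orb_subset[OF assms(1)] that by auto
    then have "q y = 0" using assms(2) q(1) by (simp add: vanishing_closure_def)
    then show ?thesis using q(2)[OF yS] by simp
  qed
  then show ?thesis using act_closed[OF assms(3) yS] by (simp add: vanishing_closure_def)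
qed

lemma clI: "x \<in> S \<Longrightarrow> (\<And>p. p \<in> R \<Longrightarrow> \<forall>a\<in>A. p a = 0 \<Longrightarrow> p x = 0) \<Longrightarrow> x \<in> cl A"
  by (simp add: vanishing_closure_def)

lemma clD: "x \<in> cl A \<Longrightarrow> p \<in> R \<Longrightarrow> \<forall>a\<in>A. p a = 0 \<Longrightarrow> p x = 0"
  by (simp add: vanishing_closure_def)

lemma subset_cl: "A \<subseteq> S \<Longrightarrow> A \<subseteq> cl A"
  by (auto intro: clI)

lemma cl_minimal:
  assumes "A \<subseteq> cl B"
  shows "cl A \<subseteq> cl B"
proof
  fix x assume x: "x \<in> cl A"
  show "x \<in> cl B"
  proof (rule clI)
    show "x \<in> S" using x by (simp add: vanishing_closure_def)
    fix p assume p: "p \<in> R" "\<forall>b\<in>B. p b = 0"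
    then have "\<forall>a\<in>A. p a = 0" using assms clD[OF _ p] by auto
    then show "p x = 0" by (rule clD[OF x p(1)])
  qed
qed

lemma cl_subset_closed:
  assumes "A \<subseteq> {x \<in> S. \<forall>p\<in>P. p x = 0}" "P \<subseteq> R"
  shows "cl A \<subseteq> {x \<in> S. \<forall>p\<in>P. p x = 0}"
proof
  fix x assume x: "x \<in> cl A"
  have "p x = 0" if p: "p \<in> P" for p
  proof (rule clD[OF x])
    show "p \<in> R" using p assms(2) by (rule subsetD[rotated])
    show "\<forall>a\<in>A. p a = 0" using p assms(1) by auto
  qed
  then show "x \<in> {x \<in> S. \<forall>p\<in>P. p x = 0}" using x by (simp add: vanishing_closure_def)
qed

lemma closedin_cl: "closedin (zariski S L) (cl A)"
  unfolding closedin_zariski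
proof (intro exI conjI)
  show "{p \<in> R. \<forall>a\<in>A. p a = 0} \<subseteq> R" by (rule Collect_restrict)
  show "cl A = {x \<in> S. \<forall>p\<in>{p \<in> R. \<forall>a\<in>A. p a = 0}. p x = 0}"
    by (simp add: vanishing_closure_def Ball_def imp_conjL)
qed

text \<open>An orbit whose closure is minimal is closed: it contains a nonempty open subset of its closure, which
  the closure of any further orbit in that closure would have to avoid.\<close>
lemma closed_orbit_exists:
  assumes OS: "\<Omega> \<subseteq> S" and stable: "\<And>g x. g \<in> carrier \<Gamma> \<Longrightarrow> x \<in> \<Omega> \<Longrightarrow> act g x \<in> \<Omega>"
    and Z: "closedin (subtopology (zariski S L) \<Omega>) Z" "Z \<noteq> {}"
    and Z_stable: "\<And>g x. g \<in> carrier \<Gamma> \<Longrightarrow> x \<in> Z \<Longrightarrow> act g x \<in> Z"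
  shows "\<exists>x\<in>Z. closedin (subtopology (zariski S L) \<Omega>) (orb x)"
proof -
  obtain P where P: "P \<subseteq> R" "Z = \<Omega> \<inter> {x \<in> S. \<forall>p\<in>P. p x = 0}"
    using Z(1) unfolding closedin_subtopology closedin_zariski by (auto simp: Int_commute)
  have ZS: "Z \<subseteq> S" using P OS by blast
  \<comment> \<open>Inclusion of closures plays the role that dimension has in the usual
    argument.\<close>
  define less where "less = {(y, x). y \<in> Z \<and> x \<in> Z \<and> cl (orb y) \<subset> cl (orb x)}"
  have "wf less"
    unfolding wf_iff_no_infinite_down_chain
  proof
    assume "\<exists>f. \<forall>i. (f (Suc i), f i) \<in> less"
    then obtain f where "\<forall>i::nat. (f (Suc i), f i) \<in> less" ..
    then have "\<forall>i. cl (orb (f (Suc i))) \<subset> cl (orb (f i))" by (simp add: less_def)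
    then show False
      using noetherian_no_descending_closures[OF poly_funs_subring noetherian_R, of S "\<lambda>i. orb (f i)"]
      by simp
  qed
  obtain z where "z \<in> Z" using Z(2) by auto
  then obtain x where x: "x \<in> Z" and min: "\<And>y. (y, x) \<in> less \<Longrightarrow> y \<notin> Z"
    by (rule wfE_min[OF \<open>wf less\<close>]) (rule that)
  have xS: "x \<in> S" using x ZS by (rule subsetD[rotated])
  obtain C where C: "C \<in> constructible R" "orb x = S \<inter> C" using constructible_orb[OF xS] by (elim bexE)
  have "S \<inter> C \<noteq> {}" using orb_self[OF xS] C(2) by auto
  from constructible_open_in_closure[OF poly_funs_subring C(1) this]
  obtain q a where q: "q \<in> R" "a \<in> orb x" "q a \<noteq> 0"
    "\<forall>y\<in>cl (orb x). q y \<noteq> 0 \<longrightarrow> y \<in> C"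
    unfolding C(2)[symmetric] by (elim bexE conjE)
  have orbZ: "orb x \<subseteq> Z" using Z_stable[OF _ x] by (auto elim: orbE)
  have "orb x = cl (orb x) \<inter> \<Omega>"
  proof (intro equalityI subsetI)
    fix y assume "y \<in> orb x"
    moreover from this have "y \<in> \<Omega>" using orbZ P(2) by auto
    ultimately show "y \<in> cl (orb x) \<inter> \<Omega>" using subset_cl[OF orb_subset[OF xS]] by auto
  next
    fix y assume y: "y \<in> cl (orb x) \<inter> \<Omega>"
    have "orb x \<subseteq> {x \<in> S. \<forall>p\<in>P. p x = 0}" using orbZ P(2) by auto
    \<comment> \<open>As \<open>Z\<close> is closed in \<open>\<Omega>\<close>, the closure of the
      orbit does not leave \<open>Z\<close> within \<open>\<Omega>\<close>; this makes
      \<open>y\<close> a competitor in the minimality of \<open>x\<close>.\<close>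
    from cl_subset_closed[OF this P(1)] have yZ: "y \<in> Z" using y P(2) by auto
    then have yS: "y \<in> S" using ZS by (rule subsetD[rotated])
    show "y \<in> orb x"
    proof (rule ccontr)
      assume n: "y \<notin> orb x"
      have orb_y: "orb y \<subseteq> cl (orb x)"
        using cl_orb_act[OF xS] y by (auto elim: orbE)
      \<comment> \<open>A point of \<open>orb y\<close> with nonzero \<open>q\<close> would lie in
        \<open>orb x\<close> and bring \<open>y\<close> with it.\<close>
      have "q z = 0" if "z \<in> orb y" for z
      proof (rule ccontr)
        assume "q z \<noteq> 0"
        moreover have "z \<in> cl (orb x)" using that orb_y by auto
        moreover from this have "z \<in> S" by (simp add: vanishing_closure_def)
        ultimately have "z \<in> orb x" using q(4) C(2) by simp
        moreover obtain g where "g \<in> carrier \<Gamma>" "z = act g y" using \<open>z \<in> orb y\<close> by (rule orbE)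
        ultimately show False using n orb_act_iff[OF xS yS] by simp
      qed
      \<comment> \<open>The point \<open>a\<close> makes the inclusion of closures strict.\<close>
      then have "a \<notin> cl (orb y)" using clD[of a "orb y" q] q(1,3) by auto
      moreover have "a \<in> cl (orb x)" using q(2) subset_cl[OF orb_subset[OF xS]] by auto
      ultimately have "cl (orb y) \<subset> cl (orb x)" using cl_minimal[OF orb_y] by auto
      then have "(y, x) \<in> less" using yZ x by (simp add: less_def)
      from min[OF this] yZ show False by simp
    qed
  qed
  then have "closedin (subtopology (zariski S L) \<Omega>) (orb x)"
    unfolding closedin_subtopology by (intro exI[of _ "cl (orb x)"] conjI closedin_cl)
  with x show ?thesis by (rule bexI[rotated])
qed

end

section \<open>Matrices\<close>

lemma GL_mat: "A \<in> carrier (GL n) \<Longrightarrow> A \<in> carrier_mat n n"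
  by (simp add: GL_carrier)

lemma GL_one: "1\<^sub>m n \<in> carrier (GL n)"
  by (simp add: GL_carrier)

lemma GL_transpose: "A \<in> carrier (GL n) \<Longrightarrow> A\<^sup>T \<in> carrier (GL n)"
  by (auto simp: GL_carrier det_transpose)

lemma GL_inv:
  assumes "A \<in> carrier (GL n)"
  shows "inv\<^bsub>GL n\<^esub> A \<in> carrier (GL n)" "inv\<^bsub>GL n\<^esub> A * A = 1\<^sub>m n" "A * inv\<^bsub>GL n\<^esub> A = 1\<^sub>m n"
proof -
  interpret group "GL n" by (rule group_GL)
  show "inv\<^bsub>GL n\<^esub> A \<in> carrier (GL n)" using assms by (rule inv_closed)
  show "inv\<^bsub>GL n\<^esub> A * A = 1\<^sub>m n" using l_inv[OF assms] by simp
  show "A * inv\<^bsub>GL n\<^esub> A = 1\<^sub>m n" using r_inv[OF assms] by simp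
qed

lemma GL_inv_eqI:
  assumes "A \<in> carrier (GL n)" "B \<in> carrier_mat n n" "B * A = 1\<^sub>m n"
  shows "inv\<^bsub>GL n\<^esub> A = B"
proof -
  interpret group "GL n" by (rule group_GL)
  have "det B * det A = 1"
    using det_mult[OF assms(2) GL_mat[OF assms(1)]] assms(3) by simp
  then have "B \<in> carrier (GL n)" using assms(2) by (auto simp: GL_carrier)
  then show ?thesis using inv_equality[of B A] assms by simp
qed

lemma GL_inv_mult:
  assumes "A \<in> carrier (GL n)" "B \<in> carrier (GL n)"
  shows "inv\<^bsub>GL n\<^esub> (A * B) = inv\<^bsub>GL n\<^esub> B * inv\<^bsub>GL n\<^esub> A"
  using group.inv_mult_group[OF group_GL assms] by simp

lemma GL_inv_inv: "A \<in> carrier (GL n) \<Longrightarrow> inv\<^bsub>GL n\<^esub> (inv\<^bsub>GL n\<^esub> A) = A"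
  using group.inv_inv[OF group_GL] by blast

lemma GL_inv_one: "inv\<^bsub>GL n\<^esub> (1\<^sub>m n) = 1\<^sub>m n"
  by (rule GL_inv_eqI[OF GL_one]) simp_all

lemma GL_inv_adj:
  assumes "A \<in> carrier (GL n)"
  shows "inv\<^bsub>GL n\<^esub> A = inverse (det A) \<cdot>\<^sub>m adj_mat A"
proof (rule GL_inv_eqI[OF assms])
  note A = GL_mat[OF assms]
  have "det A \<noteq> 0" using assms by (simp add: GL_carrier)
  show "inverse (det A) \<cdot>\<^sub>m adj_mat A \<in> carrier_mat n n" using adj_mat(1)[OF A] by simp
  have "inverse (det A) \<cdot>\<^sub>m adj_mat A * A = inverse (det A) \<cdot>\<^sub>m (adj_mat A * A)"
    by (rule mult_smult_assoc_mat[OF adj_mat(1)[OF A] A])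
  also have "\<dots> = 1\<^sub>m n"
    using \<open>det A \<noteq> 0\<close> unfolding adj_mat(3)[OF A] by (intro eq_matI) auto
  finally show "inverse (det A) \<cdot>\<^sub>m adj_mat A * A = 1\<^sub>m n" .
qed

text \<open>Cramer's rule. The inverse determinant is assumed separately because it is not
  polynomial in the entries; on \<open>GL n\<close> it is one of the generators.\<close>

lemma regular_mat_inv:
  assumes A: "regular_mat S M n n A" and "\<And>x. x \<in> S \<Longrightarrow> A x \<in> carrier (GL n)"
    and det: "regular_on S M (\<lambda>x. inverse (det (A x)))"
  shows "regular_mat S M n n (\<lambda>x. inv\<^bsub>GL n\<^esub> (A x))"
  unfolding regular_mat_def
proof (intro conjI ballI allI impI)
  show "inv\<^bsub>GL n\<^esub> (A x) \<in> carrier_mat n n" if "x \<in> S" for x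
    by (intro GL_mat GL_inv assms(2) that)
  fix i j assume ij: "i < n" "j < n"
  have "regular_on S M (\<lambda>x. inverse (det (A x)) * ((- 1) ^ (j + i) * det (mat_delete (A x) j i)))"
    by (intro regular_on_mult det regular_on_const regular_mat_det[OF regular_mat_delete[OF A]])
  then show "regular_on S M (\<lambda>x. (inv\<^bsub>GL n\<^esub> (A x)) $$ (i, j))"
  proof (rule regular_on_cong)
    fix x assume x: "x \<in> S"
    show "inverse (det (A x)) * ((- 1) ^ (j + i) * det (mat_delete (A x) j i)) = (inv\<^bsub>GL n\<^esub> (A x)) $$ (i, j)"
      using regular_matD(1)[OF A x] ij
      by (simp add: GL_inv_adj[OF assms(2)[OF x]] adj_mat_def cofactor_def)
  qed
qed

lemma regular_mat_GL: "regular_mat (carrier (GL n)) (GL_coords n) n n (\<lambda>A. A)"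
  by (auto simp: regular_mat_def GL_coords_def mat_coords_def intro!: GL_mat regular_on_gen)

lemma regular_mat_comp:
  assumes "regular_mat T L r c A" "\<And>x. x \<in> S \<Longrightarrow> h x \<in> T" "\<And>l. l \<in> L \<Longrightarrow> regular_on S M (\<lambda>x. l (h x))"
  shows "regular_mat S M r c (\<lambda>x. A (h x))"
  unfolding regular_mat_def
proof (intro conjI ballI allI impI)
  show "A (h x) \<in> carrier_mat r c" if "x \<in> S" for x
    using regular_matD(1)[OF assms(1) assms(2)[OF that]] .
  fix i j assume "i < r" "j < c"
  from regular_matD(2)[OF assms(1) this] show "regular_on S M (\<lambda>x. A (h x) $$ (i, j))"
    by (rule regular_on_comp) (use assms(2,3) in auto)
qed

section \<open>Full row rank and left kernels\<close>

lemma id_zero_carrier [simp]: "id_zero_mat m n \<in> carrier_mat m n"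
  by (simp add: id_zero_mat_def)

lemma id_zero_mult:
  assumes "m \<le> n" "B \<in> carrier_mat n c" "i < m" "j < c"
  shows "(id_zero_mat m n * B) $$ (i, j) = B $$ (i, j)"
proof -
  have "(id_zero_mat m n * B) $$ (i, j) = (\<Sum>k\<in>{0..<n}. (if i = k then 1 else 0) * B $$ (k, j))"
    using assms by (simp add: id_zero_mat_def scalar_prod_def)
  also have "\<dots> = (\<Sum>k\<in>{0..<n}. (if i = k then B $$ (k, j) else 0))"
    by (intro sum.cong) auto
  also have "\<dots> = B $$ (i, j)" using assms by simp
  finally show ?thesis .
qed

lemma mult_id_zero:
  assumes "A \<in> carrier_mat r m" "i < r" "j < n"
  shows "(A * id_zero_mat m n) $$ (i, j) = (if j < m then A $$ (i, j) else 0)"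
proof -
  have "(A * id_zero_mat m n) $$ (i, j) = (\<Sum>k\<in>{0..<m}. A $$ (i, k) * (if k = j then 1 else 0))"
    using assms by (simp add: id_zero_mat_def scalar_prod_def)
  also have "\<dots> = (\<Sum>k\<in>{0..<m}. (if k = j then A $$ (i, k) else 0))"
    by (intro sum.cong) auto
  also have "\<dots> = (if j < m then A $$ (i, j) else 0)" by simp
  finally show ?thesis .
qed

text \<open>Gauss-Jordan elimination of the transpose. If each of its \<open>m\<close> columns has a
  pivot, the reduced form is the identity above zero rows, and undoing and transposing the row
  operations yields \<open>h\<close>; otherwise a column without pivot gives a kernel
  vector.\<close>

lemma full_rank_or_left_kernel:
  fixes X :: "complex mat"
  assumes X: "X \<in> carrier_mat m n"
  shows "(\<exists>h\<in>carrier (GL n). X = id_zero_mat m n * h) \<or>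
    (\<exists>u\<in>carrier_vec m. u \<noteq> 0\<^sub>v m \<and> X\<^sup>T *\<^sub>v u = 0\<^sub>v n)"
proof -
  define C where "C = gauss_jordan_single X\<^sup>T"
  have XT: "X\<^sup>T \<in> carrier_mat n m" using X by simp
  note gj = gauss_jordan_single[OF XT C_def[symmetric]]
  show ?thesis
  proof (cases "snd ` set (pivot_positions C) = {0..<m}")
    case False
    from find_base_vector[OF gj(3,2) False] gj(1) show ?thesis by metis
  next
    case True
    have dim: "dim_row C = n" "dim_col C = m" using gj(2) by auto
    obtain f where f: "pivot_fun C f m" using gj(3) dim unfolding row_echelon_form_def by auto
    note p = pivot_funD[OF dim(1) f]
    have cover: "\<exists>i<n. f i = j" if "j < m" for j
    proof -
      have "j \<in> snd ` {(i, f i) |i. i < n \<and> f i \<noteq> m}"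
        using True that unfolding pivot_positions(1)[OF gj(2) f] by simp
      then show ?thesis by auto
    qed
    \<comment> \<open>Pivot columns strictly increase with the row, so the pivot of row
      \<open>i\<close> is at or beyond column \<open>i\<close>; if every column is hit, row
      \<open>j\<close> has its pivot exactly in column \<open>j\<close>.\<close>
    have f_id: "j < n \<and> f j = j" if "j < m" for j
      using that
    proof (induction j rule: less_induct)
      case (less j)
      obtain i where i: "i < n" "f i = j" using cover[OF less.prems] by auto
      have "i \<le> j" using pivot_bound[OF dim(1) f, of 0 i] i less.prems by auto
      moreover have "\<not> i < j"
      proof
        assume "i < j"
        then have "f i = i" using less.IH[of i] less.prems by auto
        with i \<open>i < j\<close> show False by simp
      qed
      ultimately show ?case using i by auto
    qed
    have C: "C $$ (i, j) = (if i = j then 1 else 0)" if "i < n" "j < m" for i j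
      using p(4)[of j] p(5)[of j i] f_id[OF that(2)] that by auto
    obtain P Q where PQ: "C = P * X\<^sup>T" "P \<in> carrier_mat n n" "Q \<in> carrier_mat n n"
      "P * Q = 1\<^sub>m n" "Q * P = 1\<^sub>m n" using gj(4) by metis
    have "det Q * det P = 1" using det_mult[OF PQ(3,2)] PQ(5) by simp
    then have Q: "Q\<^sup>T \<in> carrier (GL n)" using PQ(3) by (auto simp: GL_carrier det_transpose)
    have "Q * C = X\<^sup>T"
      unfolding PQ(1) using PQ(2,3,5) XT by (simp add: assoc_mult_mat[symmetric, of _ n n _ n])
    then have "X = (Q * C)\<^sup>T" by simp
    also have "\<dots> = C\<^sup>T * Q\<^sup>T" by (rule transpose_mult[OF PQ(3) gj(2)])
    also have "C\<^sup>T = id_zero_mat m n"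
      using C dim by (intro eq_matI) (auto simp: id_zero_mat_def)
    finally show ?thesis using Q by blast
  qed
qed

text \<open>Deleting row \<open>i\<close> removes the only place where the two matrices may
  differ.\<close>

lemma cofactor_cong_row:
  assumes "A \<in> carrier_mat n n" "B \<in> carrier_mat n n"
    "\<And>k l. k < n \<Longrightarrow> l < n \<Longrightarrow> k \<noteq> i \<Longrightarrow> A $$ (k, l) = B $$ (k, l)"
  shows "cofactor A i j = cofactor B i j"
proof -
  have "mat_delete A i j = mat_delete B i j"
    using assms by (intro eq_matI) (auto simp: mat_delete_def)
  then show ?thesis by (simp add: cofactor_def)
qed

lemma cofactor_one:
  assumes "i < n" "j < n"
  shows "cofactor (1\<^sub>m n :: complex mat) i j = (if i = j then 1 else 0)"
proof -
  have "adj_mat (1\<^sub>m n :: complex mat) = 1\<^sub>m n * adj_mat (1\<^sub>m n)"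
    by (rule left_mult_one_mat[OF adj_mat(1)[OF one_carrier_mat], symmetric])
  also have "\<dots> = 1\<^sub>m n" unfolding adj_mat(2)[OF one_carrier_mat] by (intro eq_matI) auto
  finally have "adj_mat (1\<^sub>m n :: complex mat) $$ (j, i) = 1\<^sub>m n $$ (j, i)" by simp
  then show ?thesis using assms by (auto simp: adj_mat_def)
qed

text \<open>The fixing matrix is the identity with the kernel vector, scaled to have entry \<open>1\<close> at a place \<open>i\<close>,
  added to row \<open>i\<close>.\<close>
lemma left_kernel_stabilizer:
  fixes X :: "complex mat"
  assumes X: "X \<in> carrier_mat m n" and u: "u \<in> carrier_vec m" "u \<noteq> 0\<^sub>v m" "X\<^sup>T *\<^sub>v u = 0\<^sub>v n"
  shows "\<exists>A\<in>carrier_mat m m. det A = 2 \<and> A * X = X"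
proof -
  obtain i where i: "i < m" "u $ i \<noteq> 0" using u(1,2) by (metis eq_vecI index_zero_vec carrier_vecD)
  define A where "A = mat m m (\<lambda>(r, k). (if r = k then 1 else 0) + (if r = i then u $ k / u $ i else 0))"
  have A: "A \<in> carrier_mat m m" by (simp add: A_def)
  \<comment> \<open>Cofactors along row \<open>i\<close> see only the other rows, which are those of
    the identity; in the expansion only the diagonal entry 1 + u_i / u_i = 2 survives.\<close>
  have "cofactor A i k = (if i = k then 1 else 0)" if "k < m" for k
    unfolding cofactor_one[OF i(1) that, symmetric]
    by (rule cofactor_cong_row[OF A]) (auto simp: A_def)
  then have "det A = (\<Sum>k<m. A $$ (i, k) * (if i = k then 1 else 0))"
    unfolding laplace_expansion_row[OF A i(1)] by (intro sum.cong) auto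
  also have "\<dots> = (\<Sum>k<m. if i = k then A $$ (i, k) else 0)"
    by (intro sum.cong) auto
  also have "\<dots> = A $$ (i, i)" using i by (simp add: sum.delta)
  also have "\<dots> = 2" using i by (simp add: A_def)
  finally have "det A = 2" .
  moreover have "A * X = X"
  proof (rule eq_matI)
    fix r s assume rs: "r < dim_row X" "s < dim_col X"
    then have rs': "r < m" "s < n" using X by auto
    have "(X\<^sup>T *\<^sub>v u) $ s = 0" using u(3) rs' by simp
    \<comment> \<open>Up to the factor \<open>1 / u $ i\<close>, this sum is what the extra entries
      of \<open>A\<close> add to row \<open>i\<close> of the product.\<close>
    then have ker: "(\<Sum>k\<in>{0..<m}. X $$ (k, s) * u $ k) = 0"
      using X u(1) rs' by (simp add: scalar_prod_def)
    have "(A * X) $$ (r, s) = (\<Sum>k\<in>{0..<m}. A $$ (r, k) * X $$ (k, s))"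
      using A X rs' by (simp add: scalar_prod_def)
    also have "\<dots> = (\<Sum>k\<in>{0..<m}. (if r = k then X $$ (k, s) else 0)
        + (if r = i then 1 / u $ i else 0) * (X $$ (k, s) * u $ k))"
      using rs' by (intro sum.cong) (auto simp: A_def field_simps)
    also have "\<dots> = X $$ (r, s)"
      using rs' by (simp add: sum.distrib sum_distrib_left[symmetric] ker)
    finally show "(A * X) $$ (r, s) = X $$ (r, s)" .
  qed (use A X in auto)
  ultimately show ?thesis using A by blast
qed

section \<open>Block diagonal matrices\<close>

abbreviation block_diag :: "nat \<Rightarrow> nat \<Rightarrow> complex mat \<Rightarrow> complex mat \<Rightarrow> complex mat" where
  "block_diag m n a b \<equiv> four_block_mat a (0\<^sub>m m (n - m)) (0\<^sub>m (n - m) m) b"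

lemma block_diag_carrier:
  "m \<le> n \<Longrightarrow> a \<in> carrier_mat m m \<Longrightarrow> b \<in> carrier_mat (n - m) (n - m) \<Longrightarrow> block_diag m n a b \<in> carrier_mat n n"
  using four_block_carrier_mat[of a m m b "n - m" "n - m"] by simp

lemma det_block_diag:
  assumes "a \<in> carrier_mat m m" "b \<in> carrier_mat (n - m) (n - m)"
  shows "det (block_diag m n a b) = det a * det b"
  using assms by (intro det_four_block_mat_lower_left_zero) auto

lemma block_diag_GL:
  "m \<le> n \<Longrightarrow> a \<in> carrier (GL m) \<Longrightarrow> b \<in> carrier (GL (n - m)) \<Longrightarrow> block_diag m n a b \<in> carrier (GL n)"
  by (simp add: GL_carrier det_block_diag block_diag_carrier)

lemma block_diag_mult:
  assumes "a \<in> carrier_mat m m" "b \<in> carrier_mat (n - m) (n - m)"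
    "a' \<in> carrier_mat m m" "b' \<in> carrier_mat (n - m) (n - m)"
  shows "block_diag m n (a * a') (b * b') = block_diag m n a b * block_diag m n a' b'"
  using assms
  by (subst mult_four_block_mat[of _ m m _ "n - m" _ "n - m" _ _ m _ "n - m"]) auto

lemma block_diag_one: "m \<le> n \<Longrightarrow> block_diag m n (1\<^sub>m m) (1\<^sub>m (n - m)) = 1\<^sub>m n"
  by (intro eq_matI) auto

lemma regular_mat_block_diag:
  assumes "m \<le> n" and a: "regular_mat S M m m a" and b: "regular_mat S M (n - m) (n - m) b"
  shows "regular_mat S M n n (\<lambda>x. block_diag m n (a x) (b x))"
  unfolding regular_mat_def
proof (intro conjI ballI allI impI)
  note ca = regular_matD(1)[OF a] and cb = regular_matD(1)[OF b]
  show "block_diag m n (a x) (b x) \<in> carrier_mat n n" if "x \<in> S" for x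
    by (rule block_diag_carrier[OF assms(1) ca[OF that] cb[OF that]])
  fix i j assume ij: "i < n" "j < n"
  consider "i < m" "j < m" | "\<not> i < m" "\<not> j < m" | "(i < m) \<noteq> (j < m)" by blast
  then show "regular_on S M (\<lambda>x. block_diag m n (a x) (b x) $$ (i, j))"
  proof cases
    case 1
    have "a x $$ (i, j) = block_diag m n (a x) (b x) $$ (i, j)" if "x \<in> S" for x
      using ca[OF that] cb[OF that] 1 ij by auto
    then show ?thesis by (rule regular_on_cong[OF regular_matD(2)[OF a 1]])
  next
    case 2
    have "b x $$ (i - m, j - m) = block_diag m n (a x) (b x) $$ (i, j)" if "x \<in> S" for x
      using ca[OF that] cb[OF that] 2 ij by auto
    moreover have ij': "i - m < n - m" "j - m < n - m" using 2 ij by auto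
    ultimately show ?thesis by (intro regular_on_cong[OF regular_matD(2)[OF b ij']])
  next
    case 3
    have "0 = block_diag m n (a x) (b x) $$ (i, j)" if "x \<in> S" for x
      using ca[OF that] cb[OF that] 3 ij by auto
    then show ?thesis by (rule regular_on_cong[OF regular_on_const])
  qed
qed

text \<open>Both sides are [a 0]. Hence left multiplication by \<open>a\<close> together with right
  multiplication by the inverse of the block matrix fixes [I 0], which is how \<open>H\<close>
  stabilizes the base point of the slice.\<close>

lemma block_diag_id_zero:
  assumes "m \<le> n" "a \<in> carrier_mat m m" "b \<in> carrier_mat (n - m) (n - m)"
  shows "a * id_zero_mat m n = id_zero_mat m n * block_diag m n a b"
proof (rule eq_matI)
  have B: "block_diag m n a b \<in> carrier_mat n n" by (rule block_diag_carrier[OF assms])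
  fix i j assume "i < dim_row (id_zero_mat m n * block_diag m n a b)"
    "j < dim_col (id_zero_mat m n * block_diag m n a b)"
  then have ij: "i < m" "j < n" using B by (auto simp: id_zero_mat_def)
  have "(a * id_zero_mat m n) $$ (i, j) = (if j < m then a $$ (i, j) else 0)"
    by (rule mult_id_zero[OF assms(2) ij])
  also have "\<dots> = block_diag m n a b $$ (i, j)" using assms ij by auto
  also have "\<dots> = (id_zero_mat m n * block_diag m n a b) $$ (i, j)"
    by (rule id_zero_mult[OF assms(1) B ij, symmetric])
  finally show "(a * id_zero_mat m n) $$ (i, j) = (id_zero_mat m n * block_diag m n a b) $$ (i, j)" .
qed (use assms block_diag_carrier[OF assms] in \<open>auto simp: id_zero_mat_def\<close>)

text \<open>The coordinates with respect to a basis are finitely many functionals, of which every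
  functional is a linear combination.\<close>

lemma linear_functionals_finite_coords:
  assumes "finite_dimensional_vector_space scale Basis"
  shows "\<exists>L0. finite L0 \<and> poly_funs L0 = poly_funs (linear_functionals scale) \<and>
    (\<forall>x y. (\<forall>l\<in>L0. l x = l y) \<longrightarrow> x = y)"
proof -
  interpret finite_dimensional_vector_space scale Basis by (rule assms)
  let ?r = "\<lambda>b y. representation Basis y b"
  define L0 where "L0 = ?r ` Basis"
  have expand: "(\<Sum>b\<in>Basis. scale (?r b y) b) = y" for y
    by (rule sum_representation_eq[OF independent_Basis]) (simp_all add: span_Basis finite_Basis)
  have "?r b \<in> linear_functionals scale" for b
    using linear_representation[OF independent_Basis span_Basis, of b]
    by (simp add: linear_functionals_def)
  then have gens: "L0 \<subseteq> poly_funs (linear_functionals scale)"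
    unfolding L0_def by (auto intro: poly_funs.gen)
  have span:  "linear_functionals scale \<subseteq> poly_funs L0"
  proof
    fix \<phi> assume "\<phi> \<in> linear_functionals scale"
    then interpret \<phi>: Vector_Spaces.linear scale "(*)" \<phi> by (simp add: linear_functionals_def)
    have "\<phi> = (\<Sum>b\<in>Basis. ?r b * (\<lambda>_. \<phi> b))"
    proof
      fix y
      have "\<phi> y = \<phi> (\<Sum>b\<in>Basis. scale (?r b y) b)" by (simp add: expand)
      also have "\<dots> = (\<Sum>b\<in>Basis. ?r b y * \<phi> b)" by (simp add: \<phi>.sum \<phi>.scale)
      finally show "\<phi> y = (\<Sum>b\<in>Basis. ?r b * (\<lambda>_. \<phi> b)) y" by (simp add: sum_fun_apply)
    qed
    moreover have "(\<Sum>b\<in>Basis. ?r b * (\<lambda>_. \<phi> b)) \<in> poly_funs L0"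
      by (intro is_subring_sum is_subringD(6) poly_funs_subring poly_funs.const poly_funs.gen)
        (simp add: L0_def)
    ultimately show "\<phi> \<in> poly_funs L0" by simp
  qed
  have "poly_funs L0 = poly_funs (linear_functionals scale)"
    by (intro equalityI poly_funs_subset gens span)
  moreover have "x = y" if "\<forall>l\<in>L0. l x = l y" for x y
  proof -
    have "(\<Sum>b\<in>Basis. scale (?r b x) b) = (\<Sum>b\<in>Basis. scale (?r b y) b)"
      using that by (intro sum.cong) (auto simp: L0_def)
    then show ?thesis by (simp add: expand)
  qed
  moreover have "finite L0" by (simp add: L0_def finite_Basis)
  ultimately show ?thesis by (intro exI[of _ L0]) simp
qed

section \<open>The slice\<close>

lemma id_zero_mult_one [simp]: "id_zero_mat m n * 1\<^sub>m n = id_zero_mat m n"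
  by (rule right_mult_one_mat[OF id_zero_carrier])

lemma finite_mat_coords: "finite (mat_coords r c)"
proof -
  have "mat_coords r c = (\<lambda>(i, j) A. A $$ (i, j)) ` ({..<r} \<times> {..<c})"
    by (auto simp: mat_coords_def)
  then show ?thesis by simp
qed

lemma finite_prod_coords: "finite L \<Longrightarrow> finite M \<Longrightarrow> finite (prod_coords L M)"
  by (simp add: prod_coords_def)

lemma prod_coords_gen_fst: "l \<in> L \<Longrightarrow> regular_on S (prod_coords L M) (\<lambda>z. l (fst z))"
  by (intro regular_on_gen) (auto simp: prod_coords_def)

lemma prod_coords_gen_snd: "l \<in> M \<Longrightarrow> regular_on S (prod_coords L M) (\<lambda>z. l (snd z))"
  by (intro regular_on_gen) (auto simp: prod_coords_def)

lemma prod_coords_cases: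
  assumes "l \<in> prod_coords L M"
  obtains k where "k \<in> L" "l = (\<lambda>z. k (fst z))" | k where "k \<in> M" "l = (\<lambda>z. k (snd z))"
  using assms by (auto simp: prod_coords_def)

text \<open>Applied in both directions, this exchanges all functionals on the second factor for a
  finite set of coordinates.\<close>

lemma poly_funs_prod_coords_mono:
  assumes "M \<subseteq> poly_funs M'"
  shows "poly_funs (prod_coords L M) \<subseteq> poly_funs (prod_coords L M')"
proof (rule poly_funs_subset, rule subsetI)
  fix l assume "l \<in> prod_coords L M"
  then show "l \<in> poly_funs (prod_coords L M')"
  proof (cases rule: prod_coords_cases)
    case (1 k)
    then show ?thesis by (auto simp: prod_coords_def intro: poly_funs.gen)
  next
    case (2 k)
    have "(\<lambda>z. k (snd z)) \<in> poly_funs (prod_coords L M')"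
      by (rule poly_funs_comp[OF subsetD[OF assms 2(1)]])
        (auto simp: prod_coords_def intro: poly_funs.gen)
    then show ?thesis by (simp add: 2)
  qed
qed

text \<open>The criterion for a matrix-valued map to be a morphism into \<open>GL n\<close>: besides
  the entries, the inverse determinant must be regular.\<close>

lemma regular_mat_entry_in_GL_coords:
  assumes l: "l \<in> GL_coords n" and A: "regular_mat S M n n A"
    and det: "regular_on S M (\<lambda>x. inverse (det (A x)))"
  shows "regular_on S M (\<lambda>x. l (A x))"
proof -
  consider "l = (\<lambda>A. inverse (det A))" | i j where "i < n" "j < n" "l = (\<lambda>A. A $$ (i, j))"
    using l by (auto simp: GL_coords_def mat_coords_def)
  then show ?thesis
  proof cases
    case 1
    then show ?thesis using det by simp
  next
    case (2 i j)
    then show ?thesis using regular_matD(2)[OF A] by simp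
  qed
qed

locale slice_setting =
  fixes m n N d e :: nat and K :: "complex mat set"
    and scale :: "complex \<Rightarrow> 'f :: ab_group_add \<Rightarrow> 'f" and Basis :: "'f set"
    and \<rho> :: "complex mat \<times> complex mat \<Rightarrow> 'f \<Rightarrow> 'f" and \<sigma>' :: "complex mat \<Rightarrow> complex"
    and f :: "complex mat \<times> 'f \<Rightarrow> complex"
  assumes mn: "m \<le> n"
    and K: "linear_algebraic_group N K"
    and fin_dim: "finite_dimensional_vector_space scale Basis"
    and rep: "rational_representation (GL n \<times>\<times> subgroup_of_GL N K)
      (prod_coords (GL_coords n) (GL_coords N)) scale \<rho>"
    and d: "d \<noteq> 0"
    and char: "rational_character (subgroup_of_GL N K) (GL_coords N) \<sigma>'"
    and semi: "f \<in> semi_invariants (G_group m n N K) (G_action m n \<rho>)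
      (V_space m n) (V_coords m n scale) (G_weight d e \<sigma>')"
begin

abbreviation "v \<equiv> id_zero_mat m n"
abbreviation "G \<equiv> G_group m n N K"
abbreviation "H \<equiv> H_group m n N K"
abbreviation "actG \<equiv> G_action m n \<rho>"
abbreviation "actH \<equiv> H_action m n \<rho>"
abbreviation "V \<equiv> V_space m n :: (complex mat \<times> 'f) set"
abbreviation "LV \<equiv> V_coords m n scale"
abbreviation "LF \<equiv> linear_functionals scale"
abbreviation "MG \<equiv> prod_coords (GL_coords m) (prod_coords (GL_coords n) (GL_coords N))"
abbreviation "MH \<equiv> prod_coords (GL_coords m) (prod_coords (GL_coords (n - m)) (GL_coords N))"

section \<open>The groups and the two actions\<close>

lemma K_subgroup: "subgroup K (GL N)"
  using K by (simp add: linear_algebraic_group_def)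

lemma group_K: "group (subgroup_of_GL N K)"
  by (rule subgroup.subgroup_is_group[OF K_subgroup group_GL])

lemma carrier_G: "carrier G = carrier (GL m) \<times> (carrier (GL n) \<times> K)"
  by (simp add: G_group_def)

lemma carrier_H: "carrier H = carrier (GL m) \<times> (carrier (GL (n - m)) \<times> K)"
  by (simp add: H_group_def)

lemma group_G: "group G"
  unfolding G_group_def by (intro DirProd_group group_GL group_K)

lemma group_H: "group H"
  unfolding H_group_def by (intro DirProd_group group_GL group_K)

lemma K_one: "1\<^sub>m N \<in> K"
  using subgroup.one_closed[OF K_subgroup] by simp

lemma G_simps [simp]: "\<one>\<^bsub>G\<^esub> = (1\<^sub>m m, 1\<^sub>m n, 1\<^sub>m N)"
  "(g, h, k) \<otimes>\<^bsub>G\<^esub> (g', h', k') = (g * g', h * h', k * k')"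
  by (simp_all add: G_group_def)

lemma H_simps [simp]: "\<one>\<^bsub>H\<^esub> = (1\<^sub>m m, 1\<^sub>m (n - m), 1\<^sub>m N)"
  "(a, b, k) \<otimes>\<^bsub>H\<^esub> (a', b', k') = (a * a', b * b', k * k')"
  by (simp_all add: H_group_def)

lemma actG_simp: "actG (g, h, k) (X, y) = (inv\<^bsub>GL m\<^esub> (g\<^sup>T) * X * inv\<^bsub>GL n\<^esub> h, \<rho> (h, k) y)"
  by (simp add: G_action_def)

lemma actH_simp: "actH (a, b, k) y = \<rho> (block_diag m n a b, k) y"
  by (simp add: H_action_def)

text \<open>As a closed subset, \<open>K\<close> inherits the presentation of \<open>GL N\<close>;
  the index type is spelled out because those of \<open>H\<close> and \<open>G\<close> are built
  from it.\<close>

lemma param_K: "\<exists>J E (\<pi> :: ((nat \<times> nat) option \<Rightarrow> complex) \<Rightarrow> _). param_by J E \<pi> K (GL_coords N)"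
proof -
  obtain P where P: "P \<subseteq> poly_funs (GL_coords N)" "K = {g \<in> carrier (GL N). \<forall>p\<in>P. p g = 0}"
    using K unfolding linear_algebraic_group_def closedin_zariski by auto
  show ?thesis unfolding P(2) by (intro exI) (rule param_by_closed[OF param_by_GL P(1)])
qed

lemma rep_linear: "h \<in> carrier (GL n) \<Longrightarrow> k \<in> K \<Longrightarrow> Vector_Spaces.linear scale scale (\<rho> (h, k))"
  using rep by (simp add: rational_representation_def)

lemma rep_one: "\<rho> (1\<^sub>m n, 1\<^sub>m N) y = y"
  using rep by (simp add: rational_representation_def)

lemma rep_mult:
  assumes "h \<in> carrier (GL n)" "k \<in> K" "h' \<in> carrier (GL n)" "k' \<in> K"
  shows "\<rho> (h * h', k * k') y = \<rho> (h, k) (\<rho> (h', k') y)"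
proof -
  have "\<forall>g\<in>carrier (GL n \<times>\<times> subgroup_of_GL N K). \<forall>h\<in>carrier (GL n \<times>\<times> subgroup_of_GL N K).
      \<forall>y. \<rho> (g \<otimes>\<^bsub>GL n \<times>\<times> subgroup_of_GL N K\<^esub> h) y = \<rho> g (\<rho> h y)"
    using rep unfolding rational_representation_def by (elim conjE)
  from bspec[OF bspec[OF this, of "(h, k)"], of "(h', k')"] show ?thesis
    using assms by simp
qed

lemma rep_regular:
  assumes "\<phi> \<in> LF"
  shows "regular_on (carrier (GL n) \<times> K) (prod_coords (GL_coords n) (GL_coords N)) (\<lambda>g. \<phi> (\<rho> g y))"
  using rep assms by (simp add: rational_representation_def)

lemma rep_functional:
  assumes "\<phi> \<in> LF" "h \<in> carrier (GL n)" "k \<in> K"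
  shows "(\<lambda>y. \<phi> (\<rho> (h, k) y)) \<in> LF"
  using Vector_Spaces.linear_compose[OF rep_linear[OF assms(2,3)], of "(*)" \<phi>] assms(1)
  by (simp add: linear_functionals_def comp_def)

lemma actH_mult:
  assumes "h \<in> carrier H" "h' \<in> carrier H"
  shows "actH (h \<otimes>\<^bsub>H\<^esub> h') y = actH h (actH h' y)"
proof -
  obtain a b k a' b' k' where h: "h = (a, b, k)" "h' = (a', b', k')" by (metis prod_cases3)
  have *: "a \<in> carrier (GL m)" "b \<in> carrier (GL (n - m))" "k \<in> K"
    "a' \<in> carrier (GL m)" "b' \<in> carrier (GL (n - m))" "k' \<in> K"
    using assms by (simp_all add: h carrier_H)
  have "block_diag m n (a * a') (b * b') = block_diag m n a b * block_diag m n a' b'"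
    by (intro block_diag_mult GL_mat *)
  then show ?thesis
    using rep_mult[OF block_diag_GL[OF mn *(1,2)] *(3) block_diag_GL[OF mn *(4,5)] *(6)]
    by (simp add: h actH_simp)
qed

lemma actH_one: "actH \<one>\<^bsub>H\<^esub> y = y"
  unfolding H_simps(1) actH_simp block_diag_one[OF mn] by (rule rep_one)

lemma actG_closed:
  assumes "g \<in> carrier G" "x \<in> V"
  shows "actG g x \<in> V"
proof -
  obtain a h k X y where g: "g = (a, h, k)" "x = (X, y)" by (metis prod_cases3 surj_pair)
  have *: "a \<in> carrier (GL m)" "h \<in> carrier (GL n)" "X \<in> carrier_mat m n"
    using assms by (simp_all add: g carrier_G V_space_def)
  have "inv\<^bsub>GL m\<^esub> (a\<^sup>T) \<in> carrier_mat m m" "inv\<^bsub>GL n\<^esub> h \<in> carrier_mat n n"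
    by (intro GL_mat GL_inv(1) GL_transpose *)+
  then show ?thesis using *(3) by (simp add: g actG_simp V_space_def)
qed

lemma actG_one: "x \<in> V \<Longrightarrow> actG \<one>\<^bsub>G\<^esub> x = x"
  by (cases x) (simp add: actG_simp V_space_def GL_inv_one rep_one)

lemma actG_mult:
  assumes "g \<in> carrier G" "g' \<in> carrier G" "x \<in> V"
  shows "actG (g \<otimes>\<^bsub>G\<^esub> g') x = actG g (actG g' x)"
proof -
  obtain a h k a' h' k' X y where g: "g = (a, h, k)" "g' = (a', h', k')" "x = (X, y)"
    by (metis prod_cases3 surj_pair)
  have *: "a \<in> carrier (GL m)" "h \<in> carrier (GL n)" "k \<in> K"
    "a' \<in> carrier (GL m)" "h' \<in> carrier (GL n)" "k' \<in> K" and X: "X \<in> carrier_mat m n"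
    using assms by (simp_all add: g carrier_G V_space_def)
  define A A' B B' where AB: "A = inv\<^bsub>GL m\<^esub> (a\<^sup>T)" "A' = inv\<^bsub>GL m\<^esub> (a'\<^sup>T)"
    "B = inv\<^bsub>GL n\<^esub> h" "B' = inv\<^bsub>GL n\<^esub> h'"
  have c: "A \<in> carrier_mat m m" "A' \<in> carrier_mat m m" "B \<in> carrier_mat n n" "B' \<in> carrier_mat n n"
    unfolding AB by (intro GL_mat GL_inv GL_transpose *)+
  have "inv\<^bsub>GL m\<^esub> ((a * a')\<^sup>T) = A * A'"
    unfolding transpose_mult[OF GL_mat[OF *(1)] GL_mat[OF *(4)]] AB
    by (intro GL_inv_mult GL_transpose *)
  moreover have "inv\<^bsub>GL n\<^esub> (h * h') = B' * B" unfolding AB by (intro GL_inv_mult *)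
  moreover have "A * A' * X * (B' * B) = A * (A' * X * B') * B"
    using c X by (simp add: assoc_mult_mat[of _ m m _ m _ n] assoc_mult_mat[of _ m m _ n _ n]
        assoc_mult_mat[of _ m n _ n _ n])
  ultimately show ?thesis
    using rep_mult[OF *(2,3,5,6)] by (simp add: g actG_simp AB)
qed

text \<open>Matrix coefficients of \<open>\<rho>\<close> are composed with the morphism (a, b, k)
  \<mapsto> (diag(a, b), k). For a fixed group element, a functional composed with the action is
  again a functional.\<close>

lemma algebraic_action_H:
  fixes J :: "'j set"
  assumes "param_by J E \<pi> K (GL_coords N)"
    and L0: "finite L0" "poly_funs L0 = poly_funs LF" "\<forall>x y. (\<forall>l\<in>L0. l x = l y) \<longrightarrow> x = y"
  shows "\<exists>J' E' (\<pi>' :: ((nat \<times> nat) option + ((nat \<times> nat) option + 'j) \<Rightarrow> complex) \<Rightarrow> _).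
    algebraic_action H MH J' E' \<pi>' actH UNIV LF L0"
proof -
  note param = param_by_prod[OF param_by_GL[of m] param_by_prod[OF param_by_GL[of "n - m"] assms(1)]]
  have regular: "regular_on (carrier H) MH (\<lambda>h. \<phi> (actH h y))" if \<phi>: "\<phi> \<in> LF" for \<phi> y
  proof -
    let ?b = "\<lambda>h :: complex mat \<times> complex mat \<times> complex mat. block_diag m n (fst h) (fst (snd h))"
    have a: "regular_mat (carrier H) MH m m fst"
      by (rule regular_mat_comp[OF regular_mat_GL])
        (auto simp: carrier_H intro: prod_coords_gen_fst)
    have "regular_mat (carrier H) MH (n - m) (n - m) (\<lambda>h. fst (snd h))"
      by (rule regular_mat_comp[OF regular_mat_GL])
        (auto simp: carrier_H prod_coords_def intro!: regular_on_gen)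
    from regular_mat_block_diag[OF mn a this] have blk: "regular_mat (carrier H) MH n n ?b" .
    \<comment> \<open>The inverse determinant of the block matrix is the product of two
      generators.\<close>
    have "regular_on (carrier H) MH (\<lambda>h. inverse (det (fst h)) * inverse (det (fst (snd h))))"
      by (intro regular_on_mult regular_on_gen) (auto simp: prod_coords_def GL_coords_def)
    then have det: "regular_on (carrier H) MH (\<lambda>h. inverse (det (?b h)))"
    proof (rule regular_on_cong)
      fix h assume "h \<in> carrier H"
      then have "det (?b h) = det (fst h) * det (fst (snd h))"
        by (intro det_block_diag) (auto simp: carrier_H intro: GL_mat)
      then show "inverse (det (fst h)) * inverse (det (fst (snd h))) = inverse (det (?b h))" by simp
    qed
    have "regular_on (carrier H) MH (\<lambda>h. \<phi> (\<rho> (?b h, snd (snd h)) y))"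
    proof (rule regular_on_comp[OF rep_regular[OF \<phi>]])
      show "(?b h, snd (snd h)) \<in> carrier (GL n) \<times> K" if "h \<in> carrier H" for h
        using that by (auto simp: carrier_H intro: block_diag_GL[OF mn])
      fix l assume "l \<in> prod_coords (GL_coords n) (GL_coords N)"
      then show "regular_on (carrier H) MH (\<lambda>h. l (?b h, snd (snd h)))"
      proof (cases rule: prod_coords_cases)
        case (1 k)
        then show ?thesis using regular_mat_entry_in_GL_coords[OF _ blk det] by simp
      next
        case (2 k)
        then show ?thesis by (auto simp: prod_coords_def intro!: regular_on_gen)
      qed
    qed
    then show ?thesis by (rule regular_on_cong) (auto simp: actH_simp split: prod.splits)
  qed
  have functional: "regular_on UNIV LF (\<lambda>y. \<phi> (actH h y))" if "h \<in> carrier H" "\<phi> \<in> LF" for h \<phi>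
  proof -
    obtain a b k where h: "h = (a, b, k)" by (metis prod_cases3)
    have "(\<lambda>y. \<phi> (actH h y)) \<in> LF"
      unfolding h actH_simp using that
      by (intro rep_functional block_diag_GL mn) (auto simp: h carrier_H)
    then show ?thesis by (rule regular_on_gen)
  qed
  obtain J' E' and \<pi>' :: "((nat \<times> nat) option + ((nat \<times> nat) option + 'j) \<Rightarrow> complex) \<Rightarrow> _"
    where P: "param_by J' E' \<pi>' (carrier H) MH"
    using param[folded carrier_H] by (rule that)
  have sep: "x = y" if "\<And>l. l \<in> L0 \<Longrightarrow> l x = l y" for x y using L0(3) that by simp
  have "algebraic_action H MH J' E' \<pi>' actH UNIV LF L0"
    by (intro algebraic_action.intro group_H P L0(1,2) sep UNIV_I actH_one actH_mult regular functional)
  then show ?thesis by (intro exI)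
qed

text \<open>The matrix component is a product of morphisms, with inverses regular by Cramer's rule,
  and the component in F is governed by the matrix coefficients of \<open>\<rho>\<close>. The finite
  coordinate set joins the matrix entries to \<open>L0\<close>.\<close>

lemma algebraic_action_G:
  fixes J :: "'j set"
  assumes "param_by J E \<pi> K (GL_coords N)"
    and L0: "finite L0" "poly_funs L0 = poly_funs LF" "\<forall>x y. (\<forall>l\<in>L0. l x = l y) \<longrightarrow> x = y"
  shows "\<exists>J' E' (\<pi>' :: ((nat \<times> nat) option + ((nat \<times> nat) option + 'j) \<Rightarrow> complex) \<Rightarrow> _).
    algebraic_action G MG J' E' \<pi>' actG V LV (prod_coords (mat_coords m n) L0)"
proof -
  let ?L = "prod_coords (mat_coords m n) L0"
  note param = param_by_prod[OF param_by_GL[of m] param_by_prod[OF param_by_GL[of n] assms(1)]]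
  have regular: "regular_on (carrier G) MG (\<lambda>g. l (actG g x))" if "x \<in> V" and l: "l \<in> LV" for l x
  proof -
    obtain X y where x: "x = (X, y)" by (cases x)
    have X: "X \<in> carrier_mat m n" using that x by (simp add: V_space_def)
    have act: "actG g x = (inv\<^bsub>GL m\<^esub> ((fst g)\<^sup>T) * X * inv\<^bsub>GL n\<^esub> (fst (snd g)), \<rho> (snd g) y)" for g
      by (cases g) (auto simp: x actG_simp)
    have g: "regular_mat (carrier G) MG m m fst"
      by (rule regular_mat_comp[OF regular_mat_GL])
        (auto simp: carrier_G intro: prod_coords_gen_fst)
    have h: "regular_mat (carrier G) MG n n (\<lambda>g. fst (snd g))"
      by (rule regular_mat_comp[OF regular_mat_GL])
        (auto simp: carrier_G prod_coords_def intro!: regular_on_gen)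
    have gdet: "regular_on (carrier G) MG (\<lambda>g. inverse (det (fst g)))"
      by (intro regular_on_gen) (auto simp: prod_coords_def GL_coords_def)
    have "regular_on (carrier G) MG (\<lambda>g. inverse (det ((fst g)\<^sup>T)))"
    proof (rule regular_on_cong[OF gdet])
      fix g assume "g \<in> carrier G"
      then have "fst g \<in> carrier_mat m m" by (auto simp: carrier_G intro: GL_mat)
      then show "inverse (det (fst g)) = inverse (det ((fst g)\<^sup>T))" by (simp add: det_transpose)
    qed
    then have ginv: "regular_mat (carrier G) MG m m (\<lambda>g. inv\<^bsub>GL m\<^esub> ((fst g)\<^sup>T))"
      by (intro regular_mat_inv regular_mat_transpose g) (auto simp: carrier_G intro: GL_transpose)
    have hinv: "regular_mat (carrier G) MG n n (\<lambda>g. inv\<^bsub>GL n\<^esub> (fst (snd g)))"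
      by (intro regular_mat_inv h regular_on_gen) (auto simp: carrier_G prod_coords_def GL_coords_def)
    have mat: "regular_mat (carrier G) MG m n (\<lambda>g. inv\<^bsub>GL m\<^esub> ((fst g)\<^sup>T) * X * inv\<^bsub>GL n\<^esub> (fst (snd g)))"
      by (intro regular_mat_mult[OF regular_mat_mult[OF ginv regular_mat_const[OF X]] hinv])
    from l show ?thesis unfolding V_coords_def
    proof (cases rule: prod_coords_cases)
      case (1 k)
      then obtain i j where "i < m" "j < n" "k = (\<lambda>A. A $$ (i, j))" by (auto simp: mat_coords_def)
      then show ?thesis using regular_matD(2)[OF mat] by (simp add: 1 act)
    next
      case (2 k)
      have "regular_on (carrier G) MG (\<lambda>g. k (\<rho> (snd g) y))"
      proof (rule regular_on_comp[OF rep_regular[OF 2(1)]])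
        show "snd g \<in> carrier (GL n) \<times> K" if "g \<in> carrier G" for g
          using that by (auto simp: carrier_G)
      qed (rule prod_coords_gen_snd)
      then show ?thesis by (simp add: 2 act)
    qed
  qed
  have space: "regular_on V LV (\<lambda>x. l (actG g x))" if "g \<in> carrier G" and l: "l \<in> LV" for g l
  proof -
    obtain a h k where g: "g = (a, h, k)" by (metis prod_cases3)
    have *: "a \<in> carrier (GL m)" "h \<in> carrier (GL n)" "k \<in> K" using that by (simp_all add: g carrier_G)
    have act: "actG g x = (inv\<^bsub>GL m\<^esub> (a\<^sup>T) * fst x * inv\<^bsub>GL n\<^esub> h, \<rho> (h, k) (snd x))" for x
      by (cases x) (auto simp: g actG_simp)
    have ia: "inv\<^bsub>GL m\<^esub> (a\<^sup>T) \<in> carrier_mat m m" and ih: "inv\<^bsub>GL n\<^esub> h \<in> carrier_mat n n"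
      by (intro GL_mat GL_inv(1) GL_transpose *)+
    have X: "regular_mat V LV m n fst"
      by (auto simp: regular_mat_def V_space_def V_coords_def prod_coords_def mat_coords_def intro!: regular_on_gen)
    have mat: "regular_mat V LV m n (\<lambda>x. inv\<^bsub>GL m\<^esub> (a\<^sup>T) * fst x * inv\<^bsub>GL n\<^esub> h)"
      by (rule regular_mat_mult[OF regular_mat_mult[OF regular_mat_const[OF ia] X] regular_mat_const[OF ih]])
    from l[unfolded V_coords_def] show ?thesis
    proof (cases rule: prod_coords_cases)
      case (1 k)
      then obtain i j where "i < m" "j < n" "k = (\<lambda>A. A $$ (i, j))" by (auto simp: mat_coords_def)
      then show ?thesis using regular_matD(2)[OF mat] by (simp add: 1 act V_coords_def)
    next
      case (2 \<phi>)
      show ?thesis unfolding 2(2) act snd_conv V_coords_def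
        by (rule prod_coords_gen_snd[OF rep_functional[OF 2(1) *(2,3)]])
    qed
  qed
  have L0_sub: "LF \<subseteq> poly_funs L0" "L0 \<subseteq> poly_funs LF"
    unfolding L0(2) by (auto intro: poly_funs.gen) (simp add: L0(2)[symmetric] poly_funs.gen)
  have L_eq: "poly_funs ?L = poly_funs LV"
    unfolding V_coords_def by (intro equalityI poly_funs_prod_coords_mono L0_sub)
  have L_fin: "finite ?L" by (intro finite_prod_coords finite_mat_coords L0)
  have sep: "x = x'" if "x \<in> V" "x' \<in> V" "\<And>l. l \<in> ?L \<Longrightarrow> l x = l x'" for x x'
  proof -
    have "fst x $$ (i, j) = fst x' $$ (i, j)" if "i < m" "j < n" for i j
    proof -
      have "(\<lambda>A. A $$ (i, j)) \<in> mat_coords m n" using that by (auto simp: mat_coords_def)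
      then have "(\<lambda>z. fst z $$ (i, j)) \<in> ?L"
        unfolding prod_coords_def by (intro UnI1 CollectI exI[of _ "\<lambda>A. A $$ (i, j)"] conjI refl)
      from \<open>\<And>l. l \<in> ?L \<Longrightarrow> l x = l x'\<close>[OF this] show ?thesis by simp
    qed
    then have "fst x = fst x'" using that(1,2) by (intro eq_matI) (auto simp: V_space_def)
    moreover have "l (snd x) = l (snd x')" if "l \<in> L0" for l
      using \<open>\<And>l. l \<in> ?L \<Longrightarrow> l x = l x'\<close>[of "\<lambda>z. l (snd z)"] that by (auto simp: prod_coords_def)
    then have "snd x = snd x'" using L0(3) by simp
    ultimately show ?thesis by (rule prod_eqI)
  qed
  obtain J' E' and \<pi>' :: "((nat \<times> nat) option + ((nat \<times> nat) option + 'j) \<Rightarrow> complex) \<Rightarrow> _"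
    where P: "param_by J' E' \<pi>' (carrier G) MG"
    using param[folded carrier_G] by (rule that)
  have "algebraic_action G MG J' E' \<pi>' actG V LV ?L"
    by (intro algebraic_action.intro group_G P L_fin L_eq sep actG_closed actG_one actG_mult regular space)
  then show ?thesis by (intro exI)
qed

section \<open>The semi-invariant and the slice\<close>

lemma semi_invariant: "g \<in> carrier G \<Longrightarrow> x \<in> V \<Longrightarrow> f (actG (inv\<^bsub>G\<^esub> g) x) = G_weight d e \<sigma>' g * f x"
  using semi by (simp add: semi_invariants_def)

lemma f_outside: "x \<notin> V \<Longrightarrow> f x = 0"
  using semi by (simp add: semi_invariants_def coord_ring_def del: split_paired_All)

lemma char_nonzero: "k \<in> K \<Longrightarrow> \<sigma>' k \<noteq> 0"
  using char by (simp add: rational_character_def)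

lemma char_one: "\<sigma>' (1\<^sub>m N) = 1"
proof -
  have "\<forall>g\<in>K. \<forall>h\<in>K. \<sigma>' (g * h) = \<sigma>' g * \<sigma>' h"
    using char unfolding rational_character_def by simp
  from bspec[OF bspec[OF this K_one] K_one]
  have "\<sigma>' (1\<^sub>m N * 1\<^sub>m N) = \<sigma>' (1\<^sub>m N) * \<sigma>' (1\<^sub>m N)" .
  then show ?thesis using char_nonzero[OF K_one] by simp
qed

text \<open>The weight is nowhere zero on \<open>G\<close>. Semi-invariance is phrased with the
  inverse of the acting element, so it is applied to the inverse of \<open>g\<close>.\<close>

lemma f_nonzero_stable:
  assumes "g \<in> carrier G" "x \<in> V" "f x \<noteq> 0"
  shows "f (actG g x) \<noteq> 0"
proof -
  interpret group G by (rule group_G)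
  obtain a h k where g: "inv\<^bsub>G\<^esub> g = (a, h, k)" by (metis prod_cases3)
  have ig: "inv\<^bsub>G\<^esub> g \<in> carrier G" by (rule inv_closed[OF assms(1)])
  then have "G_weight d e \<sigma>' (inv\<^bsub>G\<^esub> g) \<noteq> 0"
    using char_nonzero by (simp add: g carrier_G G_weight_def GL_carrier)
  then show ?thesis using semi_invariant[OF ig assms(2)] assms by simp
qed

text \<open>A row-rank deficient \<open>X\<close> is fixed by a matrix of determinant \<open>2\<close>; as \<open>d \<noteq> 0\<close>, this forces \<open>f\<close> to
  vanish there.\<close>
lemma orbit_meets_slice:
  assumes x: "x \<in> V" "f x \<noteq> 0"
  shows "\<exists>g\<in>carrier G. \<exists>y. actG g x = (v, y)"
proof -
  obtain X y where xy: "x = (X, y)" by (cases x)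
  have X: "X \<in> carrier_mat m n" using x by (simp add: xy V_space_def)
  consider h where "h \<in> carrier (GL n)" "X = v * h"
    | u where "u \<in> carrier_vec m" "u \<noteq> 0\<^sub>v m" "X\<^sup>T *\<^sub>v u = 0\<^sub>v n"
    using full_rank_or_left_kernel[OF X] by auto
  then show ?thesis
  proof cases
    case (1 h)
    have "(v * h) * inv\<^bsub>GL n\<^esub> h = v"
      using GL_inv(3)[OF 1(1)] GL_mat[OF 1(1)] GL_mat[OF GL_inv(1)[OF 1(1)]]
      by (simp add: assoc_mult_mat[of v m n h n _ n])
    moreover have "1\<^sub>m m * (v * h) = v * h"
      by (rule left_mult_one_mat[OF mult_carrier_mat[OF id_zero_carrier GL_mat[OF 1(1)]]])
    ultimately have "actG (1\<^sub>m m, h, 1\<^sub>m N) x = (v, \<rho> (h, 1\<^sub>m N) y)"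
      by (simp add: xy 1(2) actG_simp GL_inv_one)
    moreover have "(1\<^sub>m m, h, 1\<^sub>m N) \<in> carrier G" by (simp add: carrier_G GL_one 1 K_one)
    ultimately show ?thesis by blast
  next
    case (2 u)
    obtain A where A: "A \<in> carrier_mat m m" "det A = 2" "A * X = X"
      using left_kernel_stabilizer[OF X 2] by blast
    define B where "B = inv\<^bsub>GL m\<^esub> A"
    have AG: "A \<in> carrier (GL m)" using A by (simp add: GL_carrier)
    have B: "B \<in> carrier (GL m)" "B * A = 1\<^sub>m m" unfolding B_def by (rule GL_inv[OF AG])+
    have "B * X = B * (A * X)" using A(3) by simp
    also have "\<dots> = X" using assoc_mult_mat[OF GL_mat[OF B(1)] A(1) X] B(2) X by simp
    finally have BX: "B * X = X" .
    \<comment> \<open>The transpose compensates for the one in the action: \<open>g\<close> acts on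
      \<open>X\<close> by the inverse of \<open>A\<close>, which fixes \<open>X\<close> as
      well.\<close>
    define g :: "complex mat \<times> complex mat \<times> complex mat" where "g = (A\<^sup>T, 1\<^sub>m n, 1\<^sub>m N)"
    have g: "g \<in> carrier G" by (simp add: g_def carrier_G GL_one K_one GL_transpose AG)
    have fix_x: "actG g x = x"
      using X by (simp add: g_def xy actG_simp GL_inv_one rep_one BX B_def[symmetric])
    interpret group G by (rule group_G)
    have "actG (inv\<^bsub>G\<^esub> g) x = actG (inv\<^bsub>G\<^esub> g) (actG g x)" by (simp add: fix_x)
    also have "\<dots> = actG (inv\<^bsub>G\<^esub> g \<otimes>\<^bsub>G\<^esub> g) x"
      by (rule actG_mult[OF inv_closed[OF g] g x(1), symmetric])
    also have "\<dots> = x" unfolding l_inv[OF g] by (rule actG_one[OF x(1)])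
    finally have "f x = G_weight d e \<sigma>' g * f x" using semi_invariant[OF g x(1)] by simp
    then have "G_weight d e \<sigma>' g = 1" using x(2) by simp
    \<comment> \<open>Any determinant that is not a root of unity would serve; with 2 the
      contradiction is read off from absolute values.\<close>
    then have "(2 :: complex) ^ d = 1"
      using A(1,2) by (simp add: g_def G_weight_def char_one det_transpose)
    then have "norm ((2 :: complex) ^ d) = 1" by simp
    then have "(2 :: real) ^ d = 1" by (simp add: norm_power)
    then show ?thesis using one_less_power[of "2 :: real" d] d by simp
  qed
qed

text \<open>\<open>H\<close> embeds in the stabilizer of \<open>v\<close>: the first component of
  \<open>g\<close> undoes the effect of the block matrix on \<open>v\<close>. Along this embedding
  \<open>G_weight\<close> restricts to det(a)^(e-d) det(b)^e \<sigma>'(k), which is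
  \<open>H_weight\<close>.\<close>

lemma slice_action:
  assumes "h \<in> carrier H"
  shows "\<exists>g\<in>carrier G. \<forall>y. actG g (v, y) = (v, actH h y)"
proof -
  obtain a b k where h: "h = (a, b, k)" by (metis prod_cases3)
  have *: "a \<in> carrier (GL m)" "b \<in> carrier (GL (n - m))" "k \<in> K"
    using assms by (simp_all add: h carrier_H)
  let ?B = "block_diag m n a b"
  have B: "?B \<in> carrier (GL n)" by (rule block_diag_GL[OF mn *(1,2)])
  \<comment> \<open>The action inverts the transpose of its first component, so with this choice it
    multiplies by \<open>a\<close> from the left.\<close>
  define g where "g = ((inv\<^bsub>GL m\<^esub> a)\<^sup>T, ?B, k)"
  have "g \<in> carrier G" using * B by (simp add: g_def carrier_G GL_transpose GL_inv)
  moreover have "actG g (v, y) = (v, actH h y)" for y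
  proof -
    have "a * v * inv\<^bsub>GL n\<^esub> ?B = v * ?B * inv\<^bsub>GL n\<^esub> ?B"
      unfolding block_diag_id_zero[OF mn GL_mat[OF *(1)] GL_mat[OF *(2)]] ..
    also have "\<dots> = v"
      using assoc_mult_mat[OF id_zero_carrier GL_mat[OF B] GL_mat[OF GL_inv(1)[OF B]], of m] GL_inv(3)[OF B]
      by simp
    finally show ?thesis
      by (simp add: g_def h actG_simp actH_simp GL_inv_inv[OF *(1)])
  qed
  ultimately show ?thesis by blast
qed

text \<open>On the slice, matrix coordinates become constants and functionals stay functionals;
  closed subsets of \<open>V\<close> therefore meet it in closed sets.\<close>

lemma slice_comp:
  assumes "p \<in> poly_funs LV"
  shows "(\<lambda>y. p (v, y)) \<in> poly_funs LF"
proof (rule poly_funs_comp[OF assms])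
  fix l assume "l \<in> LV"
  then show "(\<lambda>y. l (v, y)) \<in> poly_funs LF" unfolding V_coords_def
    by (cases rule: prod_coords_cases) (auto intro: poly_funs.const poly_funs.gen)
qed

text \<open>The trace \<open>Z\<close> of the orbit on the slice need not be a single
  \<open>H\<close>-orbit. It is enough that it contains one that is closed in the nonvanishing
  locus, since uniqueness identifies this one with \<open>\<Omega>\<close>.\<close>

lemma closed_orbit_contains_slice_point:
  assumes A: "algebraic_action H MH J E \<pi> actH UNIV LF L0"
    and A': "algebraic_action G MG J' E' \<pi>' actG V LV L0'"
    and unique: "closed_orbits H actH UNIV LF (\<lambda>y. f (v, y)) = {\<Omega>}" "w \<in> \<Omega>"
    and x: "x \<in> V" "f x \<noteq> 0"
    and closed: "closedin (subtopology (zariski V LV) {x \<in> V. f x \<noteq> 0}) (orbit G actG x)"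
  shows "(v, w) \<in> orbit G actG x"
proof -
  interpret AH: algebraic_action H MH J E \<pi> actH UNIV LF L0 by (rule A)
  interpret AG: algebraic_action G MG J' E' \<pi>' actG V LV L0' by (rule A')
  have vV: "(v, y) \<in> V" for y by (simp add: V_space_def)
  let ?F = "{y \<in> UNIV. f (v, y) \<noteq> 0}"
  define Z where "Z = {y. (v, y) \<in> orbit G actG x}"
  obtain P where P: "P \<subseteq> poly_funs LV"
    "orbit G actG x = {x \<in> V. \<forall>p\<in>P. p x = 0} \<inter> {x \<in> V. f x \<noteq> 0}"
    using closed unfolding closedin_subtopology closedin_zariski by auto
  let ?Q = "(\<lambda>p y. p (v, y)) ` P"
  \<comment> \<open>Restricting the equations \<open>P\<close> to the slice exhibits
    \<open>Z\<close> as relatively closed.\<close>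
  have "Z = {y \<in> UNIV. \<forall>q\<in>?Q. q y = 0} \<inter> ?F"
    unfolding Z_def P(2) by (auto simp: vV)
  moreover have "?Q \<subseteq> poly_funs LF" using P(1) slice_comp by auto
  then have "closedin (zariski UNIV LF) {y \<in> UNIV. \<forall>q\<in>?Q. q y = 0}"
    unfolding closedin_zariski by (intro exI[of _ ?Q] conjI refl)
  ultimately have Z_closed: "closedin (subtopology (zariski UNIV LF) ?F) Z"
    unfolding closedin_subtopology by (intro exI conjI)
  have Z_stable: "actH h y \<in> Z" if hy: "h \<in> carrier H" "y \<in> Z" for h y
  proof -
    obtain g where g: "g \<in> carrier G" "\<forall>y. actG g (v, y) = (v, actH h y)"
      using slice_action[OF hy(1)] by auto
    have "actG g (v, y) \<in> orbit G actG x"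
      using hy(2) g(1) by (intro AG.orb_act[OF x(1)]) (simp_all add: Z_def)
    then show ?thesis using g(2) by (simp add: Z_def)
  qed
  have F_stable: "actH h y \<in> ?F" if hy: "h \<in> carrier H" "y \<in> ?F" for h y
  proof -
    obtain g where g: "g \<in> carrier G" "\<forall>y. actG g (v, y) = (v, actH h y)"
      using slice_action[OF hy(1)] by auto
    then show ?thesis using f_nonzero_stable[OF g(1) vV, of y] hy(2) by simp
  qed
  obtain g0 y0 where g0: "g0 \<in> carrier G" "actG g0 x = (v, y0)" using orbit_meets_slice[OF x] by auto
  from AG.orbI[OF g0(1), of x] have "y0 \<in> Z" by (simp add: Z_def g0(2))
  then have "Z \<noteq> {}" by auto
  from AH.closed_orbit_exists[OF subset_UNIV F_stable Z_closed this Z_stable]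
  obtain y where y: "y \<in> Z" "closedin (subtopology (zariski UNIV LF) ?F) (orbit H actH y)"
    by auto
  have "f (v, y) \<noteq> 0" using y(1) unfolding Z_def P(2) by simp
  with y(2) have "orbit H actH y \<in> closed_orbits H actH UNIV LF (\<lambda>y. f (v, y))"
    unfolding closed_orbits_def by auto
  then have "w \<in> orbit H actH y" using unique by simp
  then obtain h where "h \<in> carrier H" "w = actH h y" by (rule AH.orbE)
  then show ?thesis using Z_stable[OF _ y(1)] by (simp add: Z_def)
qed

text \<open>Distinct orbits are disjoint, so a point common to all closed orbits leaves room for
  only one. Existence is the case in which the stable closed set is the whole nonvanishing
  locus.\<close>

lemma locally_semisimple_point_slice:
  assumes f: "f \<noteq> (\<lambda>_. 0)"
    and w: "locally_semisimple_point H actH UNIV LF (\<lambda>y. f (v, y)) w"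
  shows "locally_semisimple_point G actG V LV f (v, w)"
proof -
  obtain J E and \<pi> :: "((nat \<times> nat) option \<Rightarrow> complex) \<Rightarrow> complex mat" where
    K: "param_by J E \<pi> K (GL_coords N)" using param_K by auto
  obtain L0 where L0: "finite L0" "poly_funs L0 = poly_funs LF" "\<forall>x y. (\<forall>l\<in>L0. l x = l y) \<longrightarrow> x = y"
    using linear_functionals_finite_coords[OF fin_dim] by (elim exE conjE)
  obtain J1 E1 and \<pi>1 :: "((nat \<times> nat) option + ((nat \<times> nat) option + (nat \<times> nat) option) \<Rightarrow> complex) \<Rightarrow> _"
    where A: "algebraic_action H MH J1 E1 \<pi>1 actH UNIV LF L0"
    using algebraic_action_H[OF K L0] by (elim exE)
  obtain J2 E2 and \<pi>2 :: "((nat \<times> nat) option + ((nat \<times> nat) option + (nat \<times> nat) option) \<Rightarrow> complex) \<Rightarrow> _"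
    where A': "algebraic_action G MG J2 E2 \<pi>2 actG V LV (prod_coords (mat_coords m n) L0)"
    using algebraic_action_G[OF K L0] by (elim exE)
  interpret AG: algebraic_action G MG J2 E2 \<pi>2 actG V LV "prod_coords (mat_coords m n) L0" by (rule A')
  obtain \<Omega> where \<Omega>: "closed_orbits H actH UNIV LF (\<lambda>y. f (v, y)) = {\<Omega>}" "w \<in> \<Omega>"
    using w unfolding locally_semisimple_point_def by (elim exE conjE)
  let ?V = "{x \<in> V. f x \<noteq> 0}"
  have contains: "(v, w) \<in> orbit G actG x"
    if "x \<in> V" "f x \<noteq> 0" "closedin (subtopology (zariski V LV) ?V) (orbit G actG x)" for x
    by (rule closed_orbit_contains_slice_point[OF A A' \<Omega> that])
  \<comment> \<open>Elements of the coordinate ring are extended by zero, so a point where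
    \<open>f\<close> is nonzero automatically lies in \<open>V\<close>.\<close>
  obtain x0 where "f x0 \<noteq> 0" using f by (metis ext)
  then have x0: "x0 \<in> ?V" using f_outside[of x0] by auto
  then have V_nonempty: "?V \<noteq> {}" by blast
  have V_closed: "closedin (subtopology (zariski V LV) ?V) ?V"
    using closedin_topspace[of "subtopology (zariski V LV) ?V"]
    by (simp add: topspace_zariski Int_absorb1)
  have stable: "actG g x \<in> ?V" if "g \<in> carrier G" "x \<in> ?V" for g x
    using that actG_closed f_nonzero_stable by simp
  have "\<exists>x\<in>?V. closedin (subtopology (zariski V LV) ?V) (orbit G actG x)"
    by (rule AG.closed_orbit_exists[OF Collect_restrict _ V_closed V_nonempty]; rule stable)
  then obtain x where x: "x \<in> ?V" "closedin (subtopology (zariski V LV) ?V) (orbit G actG x)"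
    by (elim bexE)
  have "closed_orbits G actG V LV f = {orbit G actG x}"
  proof (intro equalityI subsetI)
    fix \<Omega>' assume "\<Omega>' \<in> closed_orbits G actG V LV f"
    then obtain x' where x': "x' \<in> V" "f x' \<noteq> 0" "\<Omega>' = orbit G actG x'"
      "closedin (subtopology (zariski V LV) ?V) (orbit G actG x')"
      unfolding closed_orbits_def by auto
    \<comment> \<open>Both orbits are the orbit of \<open>(v, w)\<close>.\<close>
    have "orbit G actG x' = orbit G actG (v, w)"
      by (rule AG.orb_eqI[OF x'(1) contains[OF x'(1,2,4)], symmetric])
    also have "\<dots> = orbit G actG x"
      using x by (intro AG.orb_eqI contains) auto
    finally show "\<Omega>' \<in> {orbit G actG x}" using x'(3) by simp
  next
    fix \<Omega>' assume "\<Omega>' \<in> {orbit G actG x}"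
    then show "\<Omega>' \<in> closed_orbits G actG V LV f" using x unfolding closed_orbits_def by auto
  qed
  moreover have "(v, w) \<in> orbit G actG x" using x by (intro contains) auto
  ultimately show ?thesis unfolding locally_semisimple_point_def by auto
qed

end

theorem proposition2p16:
  fixes m n N d e :: nat
    and G' :: "complex mat set"
    and scale :: "complex \<Rightarrow> 'f :: ab_group_add \<Rightarrow> 'f"
    and Basis :: "'f set"
    and \<rho> :: "complex mat \<times> complex mat \<Rightarrow> 'f \<Rightarrow> 'f"
    and \<sigma>' :: "complex mat \<Rightarrow> complex"
    and f :: "complex mat \<times> 'f \<Rightarrow> complex"
    and w :: 'f
  assumes "1 \<le> m" and "m \<le> n"
    and "connected_reductive_group N G'"
    and "finite_dimensional_vector_space scale Basis"
    and "rational_representation (GL n \<times>\<times> subgroup_of_GL N G')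
           (prod_coords (GL_coords n) (GL_coords N)) scale \<rho>"
    and "d \<noteq> 0"
    and "rational_character (subgroup_of_GL N G') (GL_coords N) \<sigma>'"
    and "f \<in> semi_invariants (G_group m n N G') (G_action m n \<rho>)
               (V_space m n) (V_coords m n scale) (G_weight d e \<sigma>')"
    and "f \<noteq> (\<lambda>_. 0)"
    and "multiplicity_free (H_group m n N G') (H_action m n \<rho>)
           UNIV (linear_functionals scale) (H_weight d e \<sigma>')"
    and "locally_semisimple_point (H_group m n N G') (H_action m n \<rho>)
           UNIV (linear_functionals scale) (\<lambda>y. f (id_zero_mat m n, y)) w"
  shows "locally_semisimple_point (G_group m n N G') (G_action m n \<rho>)
           (V_space m n) (V_coords m n scale) f (id_zero_mat m n, w)"
proof -
  have "linear_algebraic_group N G'" using assms(3) by (simp add: connected_reductive_group_def)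
  then interpret slice_setting m n N d e G' scale Basis \<rho> \<sigma>' f
    by (intro slice_setting.intro assms)
  show ?thesis by (rule locally_semisimple_point_slice[OF assms(9,11)])
qed

end
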